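(* Suppose that $B_{p,\infty}^{\boldsymbol{k}}\cap C_c(K)$ is dense in $(C_c(K),\|\cdot\|_{\sup})$. Let $u\in B_{p,\infty}^{\boldsymbol{k}}\cap C_b(K)$. Then there exists a unique positive Radon measure $\Gamma_p^{\boldsymbol{k}}\langle u\rangle$ on $K$ such that for any $\varphi\in B_{p,\infty}^{\boldsymbol{k}}\cap C_c(K)$, $$\int_K\varphi\,d\Gamma_p^{\boldsymbol{k}}\langle u\rangle=\mathcal{E}_p^{\boldsymbol{k}}(u;u\varphi)-\Bigl(\frac{p-1}{p}\Bigr)^{p-1}\mathcal{E}_p^{\boldsymbol{k}}\bigl(|u|^{\frac{p}{p-1}};\varphi\bigr).$$ Moreover, $\Gamma_p^{\boldsymbol{k}}\langle u\rangle(K)\le\mathcal{E}_p^{\boldsymbol{k}}(u)<\infty$, and for any $\varphi\in C_0(K)$, $$\int_K\varphi\,d\Gamma_p^{\boldsymbol{k}}\langle u\rangle=\lim_{n\to\infty}\int_K\int_K|u(x)-u(y)|^p\varphi(x)k_{r_n}(x,y)\,m(dy)\,m(dx).$$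
   Context: Setting. $p\in(1,\infty)$; $(K,d)$ is a locally compact separable metric space with at least two points; $m$ is a $\sigma$-finite Borel measure on $K$ with full topological support; $B_d(x,r)=\{y: d(x,y)<r\}$. $C_b(K)$, $C_c(K)$ are the bounded, respectively compactly supported, continuous real functions on $K$; $C_0(K)$ is the closure of $C_c(K)$ in $(C_b(K),\|\cdot\|_{\sup})$; continuous functions are identified with their $m$-equivalence classes. A Radon measure is a Borel measure finite on compact sets. $\boldsymbol{k}=\{k_r\}_{r>0}$ is a family of $[0,\infty]$-valued Borel functions on $K\times K$; $J_{p,r}^{\boldsymbol{k}}(f)=\int_K\int_K|f(x)-f(y)|^pk_r(x,y)\,m(dy)\,m(dx)$ for $f\in L^p(K,m)$; $B_{p,\infty}^{\boldsymbol{k}}=\{f\in L^p(K,m):\sup_{r>0}J_{p,r}^{\boldsymbol{k}}(f)<\infty\}$. Standing assumptions: (1) $(\mathrm{WM})_{p,\boldsymbol{k}}$: there is $C\in[1,\infty)$ with $\sup_{r>0}J_{p,r}^{\boldsymbol{k}}(f)\le C\liminf_{r\downarrow0}J_{p,r}^{\boldsymbol{k}}(f)$ for all $f\in B_{p,\infty}^{\boldsymbol{k}}$; (2) $\boldsymbol{k}$ is asymptotically local: there is $\{\delta(r)\}_{r>0}\subseteq(0,\infty)$ with $\lim_{r\downarrow0}\delta(r)=0$ and $\lim_{r\downarrow0}\int_K\int_{K\setminus B_d(x,\delta(r))}k_r(x,y)\,m(dy)\,m(dx)=0$. Fix a sequence $r_n>0$, $r_n\to0$, such that $\mathcal{E}_p^{\boldsymbol{k}}(f):=\lim_{n\to\infty}J_{p,r_n}^{\boldsymbol{k}}(f)$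 exists in $[0,\infty)$ for every $f\in B_{p,\infty}^{\boldsymbol{k}}$ (such sequences exist under (1)). For $f,g\in B_{p,\infty}^{\boldsymbol{k}}$, $t\mapsto\mathcal{E}_p^{\boldsymbol{k}}(f+tg)$ is differentiable and $\mathcal{E}_p^{\boldsymbol{k}}(f;g):=\frac1p\frac{d}{dt}\mathcal{E}_p^{\boldsymbol{k}}(f+tg)\big|_{t=0}$. (For $u\in B_{p,\infty}^{\boldsymbol{k}}\cap C_b(K)$ and $\varphi\in B_{p,\infty}^{\boldsymbol{k}}\cap C_c(K)$ one has $u\varphi,|u|^{p/(p-1)}\in B_{p,\infty}^{\boldsymbol{k}}$.) *)

theory Defs
  imports "HOL-Analysis.Analysis"
begin

(* Elements of L^p(K,m) are handled through Borel representatives; all functionals below depend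
   only on the m-equivalence class. *)

definition Lp_fun :: "real \<Rightarrow> 'a measure \<Rightarrow> ('a \<Rightarrow> real) set" where
  "Lp_fun p m = {f \<in> borel_measurable m. integrable m (\<lambda>x. \<bar>f x\<bar> powr p)}"

definition J_fun :: "real \<Rightarrow> 'a measure \<Rightarrow> (real \<Rightarrow> 'a \<times> 'a \<Rightarrow> ennreal) \<Rightarrow> real \<Rightarrow> ('a \<Rightarrow> real) \<Rightarrow> ennreal" where
  "J_fun p m k r f =
     (\<integral>\<^sup>+ x. (\<integral>\<^sup>+ y. ennreal (\<bar>f x - f y\<bar> powr p) * k r (x, y) \<partial>m) \<partial>m)"

definition B_space :: "real \<Rightarrow> 'a measure \<Rightarrow> (real \<Rightarrow> 'a \<times> 'a \<Rightarrow> ennreal) \<Rightarrow> ('a \<Rightarrow> real) set" where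
  "B_space p m k = {f \<in> Lp_fun p m. (SUP r\<in>{0<..}. J_fun p m k r f) < \<infinity>}"

definition weak_monotone :: "real \<Rightarrow> 'a measure \<Rightarrow> (real \<Rightarrow> 'a \<times> 'a \<Rightarrow> ennreal) \<Rightarrow> bool" where
  "weak_monotone p m k \<longleftrightarrow>
     (\<exists>C::real. 1 \<le> C \<and> (\<forall>f\<in>B_space p m k.
        (SUP r\<in>{0<..}. J_fun p m k r f) \<le> ennreal C * Liminf (at_right 0) (\<lambda>r. J_fun p m k r f)))"

definition asymptotically_local ::
  "'a::metric_space measure \<Rightarrow> (real \<Rightarrow> 'a \<times> 'a \<Rightarrow> ennreal) \<Rightarrow> bool" where
  "asymptotically_local m k \<longleftrightarrow>
     (\<exists>\<delta>::real \<Rightarrow> real. (\<forall>r>0. 0 < \<delta> r) \<and> (\<delta> \<longlongrightarrow> 0) (at_right 0) \<and>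
        ((\<lambda>r. \<integral>\<^sup>+ x. (\<integral>\<^sup>+ y\<in>UNIV - ball x (\<delta> r). k r (x, y) \<partial>m) \<partial>m) \<longlongrightarrow> 0) (at_right 0))"

(* Meaningful for f in B_space, under the hypothesis that the limit along the sequence r exists. *)
definition p_energy ::
  "real \<Rightarrow> 'a measure \<Rightarrow> (real \<Rightarrow> 'a \<times> 'a \<Rightarrow> ennreal) \<Rightarrow> (nat \<Rightarrow> real) \<Rightarrow> ('a \<Rightarrow> real) \<Rightarrow> ennreal" where
  "p_energy p m k r f = lim (\<lambda>n. J_fun p m k (r n) f)"

definition p_energy_form ::
  "real \<Rightarrow> 'a measure \<Rightarrow> (real \<Rightarrow> 'a \<times> 'a \<Rightarrow> ennreal) \<Rightarrow> (nat \<Rightarrow> real) \<Rightarrow> ('a \<Rightarrow> real) \<Rightarrow> ('a \<Rightarrow> real) \<Rightarrow> real" where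
  "p_energy_form p m k r f g =
     1 / p * deriv (\<lambda>t::real. enn2real (p_energy p m k r (\<lambda>x. f x + t * g x))) 0"

(* C_b(K) is the type 'a =>C real, which carries the supremum norm. *)

definition Cc :: "('a::topological_space \<Rightarrow>\<^sub>C real) set" where
  "Cc = {f. compact (closure {x. apply_bcontfun f x \<noteq> 0})}"

definition C0 :: "('a::topological_space \<Rightarrow>\<^sub>C real) set" where
  "C0 = closure Cc"

definition radon_measure :: "'a::topological_space measure \<Rightarrow> bool" where
  "radon_measure M \<longleftrightarrow> sets M = sets borel \<and> (\<forall>A. compact A \<longrightarrow> emeasure M A < \<infinity>)"

definition is_p_energy_measure ::
  "real \<Rightarrow> 'a measure \<Rightarrow> (real \<Rightarrow> 'a \<times> 'a \<Rightarrow> ennreal) \<Rightarrow> (nat \<Rightarrow> real) \<Rightarrow>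
   ('a::topological_space \<Rightarrow>\<^sub>C real) \<Rightarrow> 'a measure \<Rightarrow> bool" where
  "is_p_energy_measure p m k r u \<Gamma> \<longleftrightarrow>
     radon_measure \<Gamma> \<and>
     (\<forall>\<phi>\<in>Cc. apply_bcontfun \<phi> \<in> B_space p m k \<longrightarrow>
        (\<integral>x. apply_bcontfun \<phi> x \<partial>\<Gamma>) =
          p_energy_form p m k r (apply_bcontfun u)
             (\<lambda>x. apply_bcontfun u x * apply_bcontfun \<phi> x)
          - ((p - 1) / p) powr (p - 1) *
            p_energy_form p m k r (\<lambda>x. \<bar>apply_bcontfun u x\<bar> powr (p / (p - 1))) (apply_bcontfun \<phi>))"

(* Signed integral of f(x) |u(x) - u(y)|^p k_s(x,y). The kernel may be infinite, so the nonnegative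
   factor is formed in ennreal (with 0 * infinity = 0) and only then made real. If J_fun p m k s u
   is finite that factor is finite almost everywhere, so the value enn2real infinity = 0 is
   irrelevant, and for bounded f the integral converges absolutely. *)
definition weighted_J ::
  "real \<Rightarrow> 'a measure \<Rightarrow> (real \<Rightarrow> 'a \<times> 'a \<Rightarrow> ennreal) \<Rightarrow> real \<Rightarrow> ('a \<Rightarrow> real) \<Rightarrow> ('a \<Rightarrow> real) \<Rightarrow> real" where
  "weighted_J p m k s u f =
     (\<integral>x. (\<integral>y. f x * enn2real (ennreal (\<bar>u x - u y\<bar> powr p) * k s (x, y)) \<partial>m) \<partial>m)"

end

theory Submission
  imports Defs
begin

text \<open>
  Write \<open>a = u x - u y\<close>, \<open>b = \<phi> x - \<phi> y\<close> and \<open>v = \<bar>u\<bar> powr (p / (p - 1))\<close>, and let \<open>\<sigma> s\<close> be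
  the signed power \<open>sgn s * \<bar>s\<bar> powr (p - 1)\<close>. The product rule
  \<open>u x * \<phi> x - u y * \<phi> y = a * \<phi> x + u y * b\<close> splits the discrete form of \<open>(u, u \<phi>)\<close> into the weighted
  energy, with integrand \<open>\<phi> x * \<bar>a\<bar> powr p\<close>, and a remainder with integrand \<open>u y * \<sigma> a * b\<close>. The exponent
  \<open>p / (p - 1)\<close> and the constant \<open>((p - 1) / p) powr (p - 1)\<close> are those for which the mean value theorem
  gives \<open>((p - 1) / p) powr (p - 1) * \<sigma> (v x - v y) = \<xi> * \<sigma> a\<close> with \<open>\<xi>\<close> between \<open>u x\<close> and \<open>u y\<close>. So the
  remainder and the constant times the discrete form of \<open>(v, \<phi>)\<close> have integrands that differ by at most
  \<open>\<bar>a\<bar> powr p * \<bar>b\<bar>\<close> (lemma \<open>signed_powr_chain_rule_error\<close>). As \<open>\<phi>\<close> is uniformly continuous, this is a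
  small multiple of \<open>\<bar>a\<bar> powr p\<close> near the diagonal, and asymptotic locality removes the rest. Hence
  the right-hand side of the defining identity is the limit of the weighted energies of \<open>\<phi>\<close>
  (lemma \<open>weighted_energy_tendsto_energy_forms\<close>).

  This uses that the form \<open>\<E>(f; g)\<close>, the derivative of a limit of energies, is the limit of the discrete
  forms. The map \<open>s \<mapsto> \<bar>s\<bar> powr p\<close> is differentiable with an error that is controlled by \<open>p\<close>-th powers, by
  homogeneity, so \<open>t \<mapsto> J(f + t g)\<close> is differentiable at \<open>0\<close> uniformly along the sequence of scales
  (lemmas \<open>abs_powr_uniformly_differentiable\<close>, \<open>limit_of_derivatives\<close>,
  \<open>energy_form_tendsto_p_energy_form\<close>).

  The weighted energies are positive and linear in \<open>\<phi>\<close> and bounded by the supremum of \<open>\<bar>\<phi>\<bar>\<close> times the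
  energy of \<open>u\<close>. By density their limit exists on all of \<open>C\<^sub>c\<close>, and it is a positive functional of norm at
  most \<open>\<E>(u)\<close>. The Riesz representation theorem, which is proved here for such functionals on metric
  spaces, yields the measure and the bound on its mass. For uniqueness, a measure that
  satisfies the identity is only known to be finite on compact sets, so a uniformly convergent
  sequence \<open>\<psi>\<close> of functions of finite energy does not suffice to control integrals; the truncations
  \<open>max 0 (\<psi> - \<epsilon>)\<close> also have finite energy and are supported where the limit is (lemma
  \<open>radon_integral_eq_limit_functional\<close>).
\<close>

section \<open>Continuous functions with compact support\<close>

text \<open>
  The functions underlying the elements of \<open>Cc\<close>: the constructions below (truncations, minima, sums) are
  carried out on plain functions.
\<close>

definition Cc_funs :: "('a::topological_space \<Rightarrow> real) set" where
  "Cc_funs = {f. continuous_on UNIV f \<and> compact (closure {x. f x \<noteq> 0})}"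

lemma Cc_funs_continuous: "f \<in> Cc_funs \<Longrightarrow> continuous_on UNIV f"
  by (simp add: Cc_funs_def)

text \<open>
  Only continuity and the zero set matter; the closure properties that follow are instances.
\<close>

lemma Cc_funs_supported:
  assumes "f \<in> Cc_funs" "g \<in> Cc_funs" "continuous_on UNIV h"
    and "\<And>x. f x = 0 \<Longrightarrow> g x = 0 \<Longrightarrow> h x = 0"
  shows "h \<in> Cc_funs"
proof -
  have "closure {x. h x \<noteq> 0} \<subseteq> closure ({x. f x \<noteq> 0} \<union> {x. g x \<noteq> 0})"
    using assms(4) by (intro closure_mono) blast
  also have "\<dots> = closure {x. f x \<noteq> 0} \<union> closure {x. g x \<noteq> 0}"
    by (rule closure_Un)
  finally have "closure {x. h x \<noteq> 0} =
      (closure {x. f x \<noteq> 0} \<union> closure {x. g x \<noteq> 0}) \<inter> closure {x. h x \<noteq> 0}"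
    by blast
  moreover have "compact ((closure {x. f x \<noteq> 0} \<union> closure {x. g x \<noteq> 0}) \<inter> closure {x. h x \<noteq> 0})"
    using assms(1,2) by (intro compact_Int_closed compact_Un) (auto simp: Cc_funs_def)
  ultimately show ?thesis
    using assms(3) by (simp add: Cc_funs_def)
qed

lemma Cc_funs_zero: "(\<lambda>x. 0) \<in> Cc_funs"
  by (simp add: Cc_funs_def)

lemma Cc_funs_add: "f \<in> Cc_funs \<Longrightarrow> g \<in> Cc_funs \<Longrightarrow> (\<lambda>x. f x + g x) \<in> Cc_funs"
  by (rule Cc_funs_supported[of f g]) (auto intro!: continuous_intros simp: Cc_funs_continuous)

lemma Cc_funs_diff: "f \<in> Cc_funs \<Longrightarrow> g \<in> Cc_funs \<Longrightarrow> (\<lambda>x. f x - g x) \<in> Cc_funs"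
  by (rule Cc_funs_supported[of f g]) (auto intro!: continuous_intros simp: Cc_funs_continuous)

lemma Cc_funs_scale: "f \<in> Cc_funs \<Longrightarrow> (\<lambda>x. c * f x) \<in> Cc_funs"
  by (rule Cc_funs_supported[of f f]) (auto intro!: continuous_intros simp: Cc_funs_continuous)

lemma Cc_funs_min:
  "f \<in> Cc_funs \<Longrightarrow> continuous_on UNIV g \<Longrightarrow> (\<And>x. 0 \<le> g x) \<Longrightarrow> (\<lambda>x. min (f x) (g x)) \<in> Cc_funs"
  by (rule Cc_funs_supported[of f f]) (auto intro!: continuous_intros simp: Cc_funs_continuous)

lemma Cc_funs_pos_part:
  "f \<in> Cc_funs \<Longrightarrow> continuous_on UNIV g \<Longrightarrow> (\<And>x. 0 \<le> g x) \<Longrightarrow> (\<lambda>x. max 0 (f x - g x)) \<in> Cc_funs"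
  by (rule Cc_funs_supported[of f f]) (auto intro!: continuous_intros simp: Cc_funs_continuous)

lemma Cc_funs_bounded:
  assumes "f \<in> Cc_funs" obtains B where "0 < B" "\<And>x. \<bar>f x\<bar> \<le> B"
proof -
  have "compact (f ` closure {x. f x \<noteq> 0})"
    using assms by (intro compact_continuous_image) (auto simp: Cc_funs_def intro: continuous_on_subset)
  then have "bounded (f ` closure {x. f x \<noteq> 0})"
    by (rule compact_imp_bounded)
  then obtain B where B: "0 < B" "\<And>y. y \<in> f ` closure {x. f x \<noteq> 0} \<Longrightarrow> norm y \<le> B"
    unfolding bounded_pos by blast
  have "\<bar>f x\<bar> \<le> B" for x
  proof (cases "f x = 0")
    case False
    then have "x \<in> closure {x. f x \<noteq> 0}" by (intro closure_subset[THEN subsetD]) simp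
    then show ?thesis using B(2)[of "f x"] by simp
  qed (use B in auto)
  with B that show thesis by blast
qed

lemma compact_superlevel:
  assumes "f \<in> Cc_funs" "0 < e" shows "compact {x. e \<le> f x}"
proof -
  have "{x. e \<le> f x} = closure {x. f x \<noteq> 0} \<inter> {x. e \<le> f x}"
    using assms(2) closure_subset[of "{x. f x \<noteq> 0}"] by auto
  moreover have "closed {x. e \<le> f x}"
    using assms(1) by (intro closed_Collect_le) (auto simp: Cc_funs_continuous)
  then have "compact (closure {x. f x \<noteq> 0} \<inter> {x. e \<le> f x})"
    using assms(1) by (intro compact_Int_closed) (auto simp: Cc_funs_def)
  ultimately show ?thesis by simp
qed

text \<open>
  Cover \<open>U\<close> by countably many balls with compact closed balls inside \<open>U\<close> and sum the tent functions over
  these balls. The factor \<open>n\<close> in front of the \<open>n\<close>-th partial sum eventually lifts it above \<open>1\<close> at every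
  point of \<open>U\<close>, so capping at \<open>1\<close> gives the indicator in the limit.
\<close>

lemma Cc_funs_increasing_to_indicator:
  fixes U :: "'a::{metric_space, second_countable_topology} set"
  assumes lc: "locally_compact_space (euclidean :: 'a topology)" and U: "open U"
  obtains \<phi> :: "nat \<Rightarrow> 'a \<Rightarrow> real" where "\<And>n. \<phi> n \<in> Cc_funs" "\<And>n x. 0 \<le> \<phi> n x"
    "\<And>n x. \<phi> n x \<le> indicator U x" "\<And>x. incseq (\<lambda>n. \<phi> n x)"
    "\<And>x. (\<lambda>n. \<phi> n x) \<longlonglongrightarrow> indicator U x"
proof (cases "U = {}")
  case True
  show thesis
    by (rule that[of "\<lambda>_ _. 0"]) (auto simp: True Cc_funs_zero incseq_def)
next
  case False
  have "\<exists>\<rho>>0. compact (cball x \<rho>) \<and> cball x \<rho> \<subseteq> U" if "x \<in> U" for x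
  proof -
    obtain V S where V: "open V" "compact S" "x \<in> V" "V \<subseteq> S"
      using lc unfolding locally_compact_space_def by auto metis
    have "open (V \<inter> U)" "x \<in> V \<inter> U" using V U that by auto
    then obtain \<rho> where \<rho>: "\<rho> > 0" "cball x \<rho> \<subseteq> V \<inter> U"
      using open_contains_cball by metis
    have "cball x \<rho> = S \<inter> cball x \<rho>" using \<rho> V by auto
    then have "compact (cball x \<rho>)" using V(2) by (metis closed_cball compact_Int_closed)
    with \<rho> show ?thesis by blast
  qed
  then obtain \<rho> where \<rho>: "\<And>x. x \<in> U \<Longrightarrow> 0 < \<rho> x" "\<And>x. x \<in> U \<Longrightarrow> compact (cball x (\<rho> x))"
      "\<And>x. x \<in> U \<Longrightarrow> cball x (\<rho> x) \<subseteq> U"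
    by metis
  define t where "t x y = max 0 (1 - dist x y / \<rho> x)" for x y
  have t_cont: "continuous_on UNIV (t x)" for x
    unfolding t_def by (cases "\<rho> x = 0") (auto intro!: continuous_intros)
  have t_off: "t x y = 0" if "x \<in> U" "y \<notin> ball x (\<rho> x)" for x y
    using that \<rho>(1) by (auto simp: t_def field_simps)
  have t_Cc: "t x \<in> Cc_funs" if x: "x \<in> U" for x
  proof -
    have "closure {y. t x y \<noteq> 0} \<subseteq> cball x (\<rho> x)"
    proof (intro closure_minimal subsetI)
      fix y assume "y \<in> {y. t x y \<noteq> 0}"
      then show "y \<in> cball x (\<rho> x)" using t_off[OF x, of y] by (cases "y \<in> ball x (\<rho> x)") auto
    qed simp
    then have "closure {y. t x y \<noteq> 0} = cball x (\<rho> x) \<inter> closure {y. t x y \<noteq> 0}" by blast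
    moreover have "compact (cball x (\<rho> x) \<inter> closure {y. t x y \<noteq> 0})"
      using \<rho>(2)[OF x] by (intro compact_Int_closed) auto
    ultimately show ?thesis
      using t_cont by (simp add: Cc_funs_def)
  qed
  have t_nonneg: "0 \<le> t x y" for x y by (simp add: t_def)
  obtain \<F> where \<F>: "\<F> \<subseteq> (\<lambda>x. ball x (\<rho> x)) ` U" "countable \<F>" "\<Union>\<F> = \<Union>((\<lambda>x. ball x (\<rho> x)) ` U)"
    by (rule Lindelof[of "(\<lambda>x. ball x (\<rho> x)) ` U"]) auto
  obtain A where A: "A \<subseteq> U" "countable A" "\<F> = (\<lambda>x. ball x (\<rho> x)) ` A"
    using \<F>(1,2) countable_subset_image[of \<F>] by metis
  have cover: "\<exists>x\<in>A. y \<in> ball x (\<rho> x)" if "y \<in> U" for y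
  proof -
    have "y \<in> ball y (\<rho> y)" using \<rho>(1)[OF that] by simp
    then have "y \<in> \<Union>\<F>" using \<F>(3) that by blast
    then show ?thesis using A(3) by blast
  qed
  have "A \<noteq> {}" using cover False by blast
  define s where "s = from_nat_into A"
  have s: "range s = A" unfolding s_def using \<open>A \<noteq> {}\<close> A(2) by (rule range_from_nat_into)
  have sU: "s i \<in> U" for i using s A(1) by blast
  define S where "S n y = real n * (\<Sum>i<n. t (s i) y)" for n y
  have S_Cc: "S n \<in> Cc_funs" for n
  proof -
    have "(\<lambda>y. \<Sum>i<n. t (s i) y) \<in> Cc_funs"
      by (induction n) (auto intro!: Cc_funs_zero Cc_funs_add t_Cc sU)
    then show ?thesis unfolding S_def[abs_def] by (rule Cc_funs_scale)
  qed
  have S_nonneg: "0 \<le> S n y" for n y unfolding S_def by (intro mult_nonneg_nonneg sum_nonneg t_nonneg) auto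
  have S_mono: "S n y \<le> S m y" if "n \<le> m" for n m y
    unfolding S_def using that by (intro mult_mono sum_mono2 sum_nonneg) (auto simp: t_nonneg)
  have S_off: "S n y = 0" if "y \<notin> U" for n y
  proof -
    have "t (s i) y = 0" for i
      using t_off[OF sU] \<rho>(3)[OF sU[of i]] ball_subset_cball that by blast
    then show ?thesis by (simp add: S_def)
  qed
  show thesis
  proof (rule that[of "\<lambda>n y. min (S n y) 1"])
    show "(\<lambda>y. min (S n y) 1) \<in> Cc_funs" for n
      using S_Cc by (intro Cc_funs_min) auto
    show "0 \<le> min (S n x) 1" "min (S n x) 1 \<le> indicator U x" for n x
      using S_nonneg S_off by (auto simp: indicator_def)
    show "incseq (\<lambda>n. min (S n x) 1)" for x
      unfolding incseq_def using S_mono by (intro allI impI min.mono) auto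
    show "(\<lambda>n. min (S n x) 1) \<longlonglongrightarrow> indicator U x" for x
    proof (cases "x \<in> U")
      case True
      then obtain i where i: "x \<in> ball (s i) (\<rho> (s i))" using cover s by blast
      define c where "c = t (s i) x"
      have c: "c > 0" using i \<rho>(1)[OF sU[of i]] by (auto simp: c_def t_def field_simps)
      have "1 \<le> S n x" if n: "n \<ge> max (Suc i) (nat \<lceil>1 / c\<rceil>)" for n
      proof -
        have "1 = (1 / c) * c" using c by simp
        also have "\<dots> \<le> real n * (\<Sum>i<n. t (s i) x)"
        proof (intro mult_mono)
          show "1 / c \<le> real n" using n by linarith
          show "c \<le> (\<Sum>i<n. t (s i) x)"
            unfolding c_def using n by (intro member_le_sum) (auto simp: t_nonneg)
        qed (use c in auto)
        finally show ?thesis by (simp add: S_def)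
      qed
      then have "\<forall>\<^sub>F n in sequentially. min (S n x) 1 = indicator U x"
        unfolding eventually_sequentially using True by (intro exI[of _ "max (Suc i) (nat \<lceil>1 / c\<rceil>)"]) auto
      then show ?thesis by (rule tendsto_eventually)
    qed (simp add: S_off)
  qed
qed

text \<open>
  The open sets are an intersection-stable generator of the Borel sets, and the measure of an open
  set is a limit of integrals of functions in \<open>Cc_funs\<close>.
\<close>

lemma finite_measure_eqI_Cc_funs:
  fixes \<mu> \<nu> :: "'a::{metric_space, second_countable_topology} measure"
  assumes lc: "locally_compact_space (euclidean :: 'a topology)"
    and sets: "sets \<mu> = sets borel" "sets \<nu> = sets borel"
    and fin: "finite_measure \<mu>" "finite_measure \<nu>"
    and eq: "\<And>f. f \<in> Cc_funs \<Longrightarrow> integral\<^sup>L \<mu> f = integral\<^sup>L \<nu> f"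
  shows "\<mu> = \<nu>"
proof -
  have lim: "(\<lambda>n. integral\<^sup>L \<kappa> (\<phi> n)) \<longlonglongrightarrow> measure \<kappa> U"
    if "sets \<kappa> = sets borel" "finite_measure \<kappa>" "open U" "\<And>n. \<phi> n \<in> Cc_funs" "\<And>n x. 0 \<le> \<phi> n x"
      "\<And>n x. \<phi> n x \<le> indicator U x" "\<And>x. (\<lambda>n. \<phi> n x) \<longlonglongrightarrow> indicator U x"
    for \<kappa> :: "'a measure" and \<phi> and U
  proof -
    interpret finite_measure \<kappa> by fact
    have "(\<lambda>n. integral\<^sup>L \<kappa> (\<phi> n)) \<longlonglongrightarrow> integral\<^sup>L \<kappa> (indicator U)"
    proof (rule integral_dominated_convergence[where w = "\<lambda>_. 1"])

      show "\<phi> n \<in> borel_measurable \<kappa>" for n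
        using borel_measurable_continuous_onI[OF Cc_funs_continuous[OF that(4)[of n]]]
        unfolding measurable_cong_sets[OF that(1) refl] .
      show "(indicator U :: 'a \<Rightarrow> real) \<in> borel_measurable \<kappa>"
        using that(1,3) by (intro borel_measurable_indicator) simp
      have "\<phi> n x \<le> 1" for n x using that(6)[of n x] by (cases "x \<in> U") auto
      then show "AE x in \<kappa>. norm (\<phi> n x) \<le> 1" for n
        using that(5) by simp
      show "AE x in \<kappa>. (\<lambda>n. \<phi> n x) \<longlonglongrightarrow> indicator U x" by (simp add: that(7))
      show "integrable \<kappa> (\<lambda>_. 1 :: real)" by simp
    qed
    then show ?thesis by (simp add: that(1,3))
  qed
  show ?thesis
  proof (rule measure_eqI_generator_eq[where E = "{U. open U}" and \<Omega> = UNIV and A = "\<lambda>_. UNIV"])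
    show "Int_stable {U::'a set. open U}" by (auto simp: Int_stable_def)
    fix U :: "'a set" assume "U \<in> {U. open U}"
    then have U: "open U" by simp
    obtain \<phi> :: "nat \<Rightarrow> 'a \<Rightarrow> real" where \<phi>: "\<And>n. \<phi> n \<in> Cc_funs" "\<And>n x. 0 \<le> \<phi> n x"
      "\<And>n x. \<phi> n x \<le> indicator U x" "\<And>x. (\<lambda>n. \<phi> n x) \<longlonglongrightarrow> indicator U x"
      using Cc_funs_increasing_to_indicator[OF lc U] by metis
    have "(\<lambda>n. integral\<^sup>L \<mu> (\<phi> n)) \<longlonglongrightarrow> measure \<mu> U" "(\<lambda>n. integral\<^sup>L \<nu> (\<phi> n)) \<longlonglongrightarrow> measure \<nu> U"
      using lim[OF sets(1) fin(1) U \<phi>] lim[OF sets(2) fin(2) U \<phi>] by auto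
    then have "measure \<mu> U = measure \<nu> U"
      using eq[OF \<phi>(1)] LIMSEQ_unique by auto
    then show "emeasure \<mu> U = emeasure \<nu> U"
      using fin by (simp add: finite_measure.emeasure_eq_measure)
  next
    show "sets \<mu> = sigma_sets UNIV {U. open U}" "sets \<nu> = sigma_sets UNIV {U. open U}"
      using sets by (simp_all add: borel_def)
    show "emeasure \<mu> UNIV \<noteq> \<infinity>" for i :: nat
      using finite_measure.emeasure_finite[OF fin(1)] by simp
  qed auto
qed

text \<open>
  A Lebesgue number of the cover of the support by preimages of small balls controls every pair of
  points of which one lies in the support; on all other pairs the function vanishes.
\<close>

lemma Cc_funs_uniformly_continuous:
  fixes f :: "'a::metric_space \<Rightarrow> real"
  assumes f: "f \<in> Cc_funs" shows "uniformly_continuous_on UNIV f"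
  unfolding uniformly_continuous_on_def
proof (intro allI impI)
  fix e :: real assume e: "0 < e"
  define S where "S = closure {x. f x \<noteq> 0}"
  have S: "compact S" using f by (simp add: S_def Cc_funs_def)
  have off: "f x = 0" if "x \<notin> S" for x
    using that closure_subset[of "{x. f x \<noteq> 0}"] by (auto simp: S_def)
  define \<G> where "\<G> = (\<lambda>c. f -` ball c (e / 2)) ` UNIV"
  have "S \<subseteq> \<Union>\<G>"
  proof
    fix x
    have "x \<in> f -` ball (f x) (e / 2)" using e by simp
    then show "x \<in> \<Union>\<G>" unfolding \<G>_def by blast
  qed
  moreover have "open G" if "G \<in> \<G>" for G
    using that Cc_funs_continuous[OF f] by (auto simp: \<G>_def intro!: open_vimage)
  ultimately obtain d where d: "0 < d" "\<And>x. x \<in> S \<Longrightarrow> \<exists>G\<in>\<G>. ball x d \<subseteq> G"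
    using Heine_Borel_lemma[OF S] by metis
  have near: "dist (f y) (f x) < e" if x: "x \<in> S" and xy: "dist y x < d" for x y
  proof -
    obtain c where c: "ball x d \<subseteq> f -` ball c (e / 2)" using d(2)[OF x] by (auto simp: \<G>_def)
    have "x \<in> ball x d" "y \<in> ball x d" using d(1) xy by (simp_all add: dist_commute)
    then have "f x \<in> ball c (e / 2)" "f y \<in> ball c (e / 2)" using c by blast+
    then have "dist c (f x) < e / 2" "dist c (f y) < e / 2" by simp_all
    then show ?thesis unfolding dist_real_def by linarith
  qed
  have "dist (f y) (f x) < e" if xy: "dist y x < d" for x y
  proof -
    consider "x \<in> S" | "y \<in> S" | "x \<notin> S" "y \<notin> S" by blast
    then show ?thesis
    proof cases
      case 1 then show ?thesis using near xy by blast
    next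
      case 2 then show ?thesis using near[of y x] xy by (simp add: dist_commute)
    next
      case 3 then show ?thesis using off e by simp
    qed
  qed
  then show "\<exists>d>0. \<forall>x\<in>UNIV. \<forall>x'\<in>UNIV. dist x' x < d \<longrightarrow> dist (f x') (f x) < e"
    using d(1) by blast
qed

section \<open>The Riesz representation theorem for bounded positive functionals\<close>

text \<open>
  The number \<open>M\<close> bounds the norm of the functional and becomes a bound for the total mass of the
  representing measure. It also makes truncation cheap: lowering a function by \<open>e\<close> costs at
  most \<open>M * e\<close>.
\<close>

locale bounded_positive_functional =
  fixes I :: "('a::metric_space \<Rightarrow> real) \<Rightarrow> real" and M :: real
  assumes add: "f \<in> Cc_funs \<Longrightarrow> g \<in> Cc_funs \<Longrightarrow> I (\<lambda>x. f x + g x) = I f + I g"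
    and scale: "f \<in> Cc_funs \<Longrightarrow> I (\<lambda>x. c * f x) = c * I f"
    and nonneg: "f \<in> Cc_funs \<Longrightarrow> (\<And>x. 0 \<le> f x) \<Longrightarrow> 0 \<le> I f"
    and bound: "f \<in> Cc_funs \<Longrightarrow> (\<And>x. \<bar>f x\<bar> \<le> B) \<Longrightarrow> \<bar>I f\<bar> \<le> M * B"
begin

lemma M_nonneg: "0 \<le> M"
  using bound[OF Cc_funs_zero, of 1] by (auto intro: order_trans[OF abs_ge_zero])

lemma I_mono:
  assumes "f \<in> Cc_funs" "g \<in> Cc_funs" "\<And>x. f x \<le> g x" shows "I f \<le> I g"
proof -
  have "I g = I f + I (\<lambda>x. g x - f x)"
    using add[OF assms(1) Cc_funs_diff[OF assms(2,1)]] by simp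
  then show ?thesis using nonneg[OF Cc_funs_diff[OF assms(2,1)]] assms(3) by simp
qed

text \<open>
  The positive set of \<open>max 0 (f - e)\<close> lies in the compact set \<open>{e \<le> f}\<close>. All compactness arguments below
  enter through this truncation.
\<close>

lemma I_truncate_le:
  assumes "f \<in> Cc_funs" "\<And>x. 0 \<le> f x" "0 \<le> e"
  shows "I f \<le> I (\<lambda>x. max 0 (f x - e)) + M * e"
proof -
  have *: "(\<lambda>x. max 0 (f x - e)) \<in> Cc_funs" "(\<lambda>x. min (f x) e) \<in> Cc_funs"
    using assms by (auto intro!: Cc_funs_pos_part Cc_funs_min)
  have "(\<lambda>x. max 0 (f x - e) + min (f x) e) = f"
    by (auto simp: max_def min_def)
  then have "I f = I (\<lambda>x. max 0 (f x - e)) + I (\<lambda>x. min (f x) e)"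
    using add[OF *] by simp
  moreover have "\<bar>I (\<lambda>x. min (f x) e)\<bar> \<le> M * e"
    using assms(2,3) by (intro bound[OF *(2)]) (auto simp: min_def)
  ultimately show ?thesis by linarith
qed

text \<open>
  Test functions are compared with the indicator of \<open>U\<close> pointwise; their supports may meet the boundary
  of \<open>U\<close>. Up to an arbitrarily small error, truncation moves them into \<open>U\<close>.
\<close>

definition open_content :: "'a set \<Rightarrow> ennreal" where
  "open_content U = (SUP f\<in>{f \<in> Cc_funs. \<forall>x. 0 \<le> f x \<and> f x \<le> indicator U x}. ennreal (I f))"

definition outer :: "'a set \<Rightarrow> ennreal" where
  "outer A = (INF U\<in>{U. open U \<and> A \<subseteq> U}. open_content U)"

lemma open_content_ge:
  "f \<in> Cc_funs \<Longrightarrow> (\<And>x. 0 \<le> f x) \<Longrightarrow> (\<And>x. f x \<le> indicator U x) \<Longrightarrow> ennreal (I f) \<le> open_content U"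
  unfolding open_content_def by (rule SUP_upper) simp

lemma open_content_le:
  assumes "\<And>f. f \<in> Cc_funs \<Longrightarrow> (\<And>x. 0 \<le> f x) \<Longrightarrow> (\<And>x. f x \<le> indicator U x) \<Longrightarrow> ennreal (I f) \<le> c"
  shows "open_content U \<le> c"
  unfolding open_content_def by (rule SUP_least) (use assms in auto)

lemma open_content_mono: "U \<subseteq> V \<Longrightarrow> open_content U \<le> open_content V"
proof (rule open_content_le)
  fix f :: "'a \<Rightarrow> real"
  assume UV: "U \<subseteq> V" and f: "f \<in> Cc_funs" "\<And>x. 0 \<le> f x" "\<And>x. f x \<le> indicator U x"
  have "f x \<le> indicator V x" for x
    using f(3)[of x] UV by (cases "x \<in> U") (auto simp: indicator_def)
  with f(1,2) show "ennreal (I f) \<le> open_content V" by (rule open_content_ge)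
qed

lemma open_content_empty: "open_content {} = 0"
proof -
  have "open_content {} \<le> 0"
  proof (rule open_content_le)
    fix f :: "'a \<Rightarrow> real" assume f: "f \<in> Cc_funs" "\<And>x. 0 \<le> f x" "\<And>x. f x \<le> indicator {} x"
    have "\<bar>I f\<bar> \<le> M * 0" using f by (intro bound) (auto intro: antisym)
    then show "ennreal (I f) \<le> 0" by simp
  qed
  then show ?thesis by simp
qed

lemma open_content_UNIV: "open_content UNIV \<le> ennreal M"
proof (rule open_content_le)
  fix f :: "'a \<Rightarrow> real" assume f: "f \<in> Cc_funs" "\<And>x. 0 \<le> f x" "\<And>x. f x \<le> indicator UNIV x"
  have "\<bar>I f\<bar> \<le> M * 1" using f by (intro bound) auto
  then show "ennreal (I f) \<le> ennreal M" by (intro ennreal_leI) simp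
qed

lemma open_content_less_top: "open_content U < top"
  using open_content_mono[of U UNIV] open_content_UNIV
  by (metis ennreal_less_top order_le_less_trans subset_UNIV)

text \<open>
  Estimates of \<open>open_content\<close> may be verified for truncated test functions, whose positive set lies in
  a compact subset of \<open>U\<close>. The summand \<open>b\<close> is there for the Caratheodory condition, which bounds a sum of
  two contents.
\<close>

lemma open_content_add_le_truncated:
  assumes "\<And>f e. f \<in> Cc_funs \<Longrightarrow> (\<And>x. 0 \<le> f x) \<Longrightarrow> (\<And>x. f x \<le> indicator U x) \<Longrightarrow> 0 < e \<Longrightarrow>
     ennreal (I (\<lambda>x. max 0 (f x - e))) + b \<le> c"
  shows "open_content U + b \<le> c"
proof -
  have "ennreal (I f) + b \<le> c"
    if f: "f \<in> Cc_funs" "\<And>x. 0 \<le> f x" "\<And>x. f x \<le> indicator U x" for f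
  proof (rule ennreal_le_epsilon)
    fix e :: real assume e: "0 < e"
    \<comment> \<open>The summand \<open>1\<close> covers the case \<open>M = 0\<close>.\<close>
    define d where "d = e / (M + 1)"
    have d: "0 < d" "M * d \<le> e"
      using e M_nonneg by (auto simp: d_def field_simps)
    have g: "(\<lambda>x. max 0 (f x - d)) \<in> Cc_funs" using f d by (intro Cc_funs_pos_part) auto
    have "ennreal (I f) \<le> ennreal (I (\<lambda>x. max 0 (f x - d)) + M * d)"
      using I_truncate_le[OF f(1,2), of d] d by (intro ennreal_leI) simp
    also have "\<dots> = ennreal (I (\<lambda>x. max 0 (f x - d))) + ennreal (M * d)"
      using nonneg[OF g] M_nonneg d by (intro ennreal_plus) auto
    also have "\<dots> \<le> ennreal (I (\<lambda>x. max 0 (f x - d))) + ennreal e"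
      by (intro add_left_mono ennreal_leI d)
    finally have "ennreal (I f) + b \<le> (ennreal (I (\<lambda>x. max 0 (f x - d))) + b) + ennreal e"
      by (simp add: add_right_mono ac_simps)
    also have "\<dots> \<le> c + ennreal e"
      by (intro add_right_mono assms f d)
    finally show "ennreal (I f) + b \<le> c + ennreal e" .
  qed
  moreover have "{f \<in> Cc_funs. \<forall>x. 0 \<le> f x \<and> f x \<le> indicator U x} \<noteq> {}"
    using Cc_funs_zero by fastforce
  ultimately show ?thesis
    unfolding open_content_def by (subst ennreal_SUP_add_left[symmetric]) (auto intro!: SUP_least)
qed

text \<open>
  Split \<open>f = min f g + max 0 (f - g)\<close>, where \<open>g\<close> is a multiple of the distance to the complement of \<open>U\<close>.
  The first part lives in \<open>U\<close>. The part of \<open>{d \<le> f}\<close> outside \<open>V\<close> is a compact subset of \<open>U\<close>, so a large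
  multiple satisfies \<open>1 \<le> g\<close> there, and the truncation of the second part lives in \<open>V\<close>.
\<close>

lemma open_content_Un:
  assumes "open U" "open V"
  shows "open_content (U \<union> V) \<le> open_content U + open_content V"
proof (cases "U = UNIV")
  case True
  then show ?thesis by (simp add: add_increasing2)
next
  case False
  show ?thesis
  proof (rule open_content_le)
    fix f :: "'a \<Rightarrow> real" assume f: "f \<in> Cc_funs" "\<And>x. 0 \<le> f x" "\<And>x. f x \<le> indicator (U \<union> V) x"
    have f1: "f x \<le> 1" for x using order_trans[OF f(3)[of x], of 1] by (auto simp: indicator_def)
    show "ennreal (I f) \<le> open_content U + open_content V"
    proof (rule ennreal_le_epsilon)
      fix e :: real assume e: "0 < e"
      define d where "d = e / (M + 1)"
      have d: "0 < d" "M * d \<le> e"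
        using e M_nonneg by (auto simp: d_def field_simps)
      define C where "C = {x. d \<le> f x} - V"
      have "compact C" unfolding C_def using f(1) d \<open>open V\<close>
        by (intro compact_diff compact_superlevel)
      have CU: "0 < infdist x (- U)" if "x \<in> C" for x
      proof -
        have "f x > 0" "x \<notin> V" using that d by (auto simp: C_def)
        then have "x \<in> U" using f(3)[of x] by (cases "x \<in> U") auto
        then show ?thesis
          using False \<open>open U\<close> by (intro infdist_pos_not_in_closed) auto
      qed
      obtain \<eta> where \<eta>: "0 < \<eta>" "\<And>x. x \<in> C \<Longrightarrow> \<eta> \<le> infdist x (- U)"
      proof (cases "C = {}")
        case True then show thesis using that[of 1] by simp
      next
        case False
        have "continuous_on C (\<lambda>x. infdist x (- U))" by (intro continuous_intros)
        then obtain x where x: "x \<in> C" "\<And>y. y \<in> C \<Longrightarrow> infdist x (- U) \<le> infdist y (- U)"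
          using continuous_attains_inf[OF \<open>compact C\<close> False] by metis
        then show thesis using CU that by blast
      qed
      define g where "g x = infdist x (- U) / \<eta>" for x
      have g: "continuous_on UNIV g" "0 \<le> g x" for x
        using \<eta> by (auto simp: g_def[abs_def] infdist_nonneg intro!: continuous_intros)
      have g0: "g x = 0" if "x \<notin> U" for x using that by (simp add: g_def)
      have f2: "(\<lambda>x. min (f x) (g x)) \<in> Cc_funs" "(\<lambda>x. max 0 (f x - g x)) \<in> Cc_funs"
        using f g by (auto intro!: Cc_funs_pos_part Cc_funs_min)
      have f3: "(\<lambda>x. max 0 (max 0 (f x - g x) - d)) \<in> Cc_funs"
        using d by (intro Cc_funs_pos_part[OF f2(2)]) auto
      have "(\<lambda>x. min (f x) (g x) + max 0 (f x - g x)) = f"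
        by (auto simp: max_def min_def)
      then have "I f = I (\<lambda>x. min (f x) (g x)) + I (\<lambda>x. max 0 (f x - g x))"
        using add[OF f2] by simp
      also have "\<dots> \<le> I (\<lambda>x. min (f x) (g x)) + (I (\<lambda>x. max 0 (max 0 (f x - g x) - d)) + M * d)"
        using d f2 by (intro add_left_mono I_truncate_le) auto
      finally have "ennreal (I f) \<le>
          ennreal (I (\<lambda>x. min (f x) (g x)) + (I (\<lambda>x. max 0 (max 0 (f x - g x) - d)) + M * d))"
        by (rule ennreal_leI)
      also have "\<dots> = ennreal (I (\<lambda>x. min (f x) (g x))) +
          ennreal (I (\<lambda>x. max 0 (max 0 (f x - g x) - d))) + ennreal (M * d)"
        using nonneg[OF f2(1)] nonneg[OF f3] f g M_nonneg d by (simp add: add.assoc)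
      also have "ennreal (I (\<lambda>x. min (f x) (g x))) \<le> open_content U"
      proof (intro open_content_ge f2(1))
        show "0 \<le> min (f x) (g x)" for x using f(2) g(2) by simp
        show "min (f x) (g x) \<le> indicator U x" for x
          using f1[of x] g0[of x] by (cases "x \<in> U") auto
      qed
      also have "ennreal (I (\<lambda>x. max 0 (max 0 (f x - g x) - d))) \<le> open_content V"
      proof (intro open_content_ge f3)
        fix x
        show "max 0 (max 0 (f x - g x) - d) \<le> indicator V x"
        proof (cases "x \<in> V")
          case True
          then show ?thesis using f1[of x] g(2)[of x] d by auto
        next
          case nV: False
          show ?thesis
          proof (cases "x \<in> C")
            case True
            then have "1 \<le> g x" using \<eta> by (simp add: g_def)
            then show ?thesis using f1[of x] d by auto
          next
            case False
            then show ?thesis using nV g(2)[of x] d by (auto simp: C_def)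
          qed
        qed
      qed auto
      also have "ennreal (M * d) \<le> ennreal e" using d by (intro ennreal_leI)
      finally show "ennreal (I f) \<le> open_content U + open_content V + ennreal e"
        by (simp add: add_mono)
    qed
  qed
qed

text \<open>
  The compact set \<open>{e \<le> f}\<close> is already contained in one of the \<open>U n\<close>.
\<close>

lemma open_content_UN_incseq:
  assumes U: "\<And>n. open (U n)" "incseq U"
  shows "open_content (\<Union>n. U n) \<le> (SUP n. open_content (U n))"
proof (rule open_content_add_le_truncated[where b = 0, simplified])
  fix f :: "'a \<Rightarrow> real" and e :: real
  assume f: "f \<in> Cc_funs" "\<And>x. 0 \<le> f x" "\<And>x. f x \<le> indicator (\<Union>n. U n) x" and e: "0 < e"
  have f1: "f x \<le> 1" for x using order_trans[OF f(3)[of x], of 1] by (auto simp: indicator_def)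
  define C where "C = {x. e \<le> f x}"
  have "compact C" unfolding C_def using f(1) e by (rule compact_superlevel)
  moreover have "C \<subseteq> (\<Union>n. U n)"
  proof
    fix x assume "x \<in> C"
    then show "x \<in> (\<Union>n. U n)"
      using f(3)[of x] e by (cases "x \<in> (\<Union>n. U n)") (auto simp: C_def)
  qed
  ultimately obtain F where F: "finite F" "C \<subseteq> (\<Union>n\<in>F. U n)"
    using compactE_image[of C UNIV U] U(1) by auto
  have CM: "C \<subseteq> U (Max (insert 0 F))"
  proof
    fix x assume "x \<in> C"
    then obtain n where "n \<in> F" "x \<in> U n" using F by auto
    moreover have "n \<le> Max (insert 0 F)" using F(1) \<open>n \<in> F\<close> by simp
    ultimately show "x \<in> U (Max (insert 0 F))" using U(2) by (auto simp: incseq_def)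
  qed
  have "ennreal (I (\<lambda>x. max 0 (f x - e))) \<le> open_content (U (Max (insert 0 F)))"
  proof (intro open_content_ge)
    show "max 0 (f x - e) \<le> indicator (U (Max (insert 0 F))) x" for x
      using CM f1[of x] e by (cases "x \<in> C") (auto simp: C_def indicator_def)
  qed (use f e in \<open>auto intro!: Cc_funs_pos_part\<close>)
  also have "\<dots> \<le> (SUP n. open_content (U n))" by (rule SUP_upper) simp
  finally show "ennreal (I (\<lambda>x. max 0 (f x - e))) \<le> (SUP n. open_content (U n))" .
qed

lemma open_content_UN:
  fixes U :: "nat \<Rightarrow> 'a set"
  assumes U: "\<And>n. open (U n)"
  shows "open_content (\<Union>n. U n) \<le> (\<Sum>n. open_content (U n))"
proof -
  have fin: "open_content (\<Union>i<n. U i) \<le> (\<Sum>i<n. open_content (U i))" for n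
  proof (induction n)
    case 0
    show ?case by (simp add: open_content_empty)
  next
    case (Suc n)
    have "open_content (\<Union>i<Suc n. U i) = open_content ((\<Union>i<n. U i) \<union> U n)"
      by (simp add: lessThan_Suc Un_commute)
    also have "\<dots> \<le> open_content (\<Union>i<n. U i) + open_content (U n)"
      using U by (intro open_content_Un open_UN) auto
    also have "\<dots> \<le> (\<Sum>i<Suc n. open_content (U i))" using Suc by (simp add: add_right_mono)
    finally show ?case .
  qed
  \<comment> \<open>Pass to increasing partial unions, so that compactness applies.\<close>
  have "(\<Union>n. U n) = (\<Union>n. \<Union>i<n. U i)" by (auto intro: lessI)
  then have "open_content (\<Union>n. U n) = open_content (\<Union>n. \<Union>i<n. U i)" by simp
  also have "\<dots> \<le> (SUP n. open_content (\<Union>i<n. U i))"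
    using U by (intro open_content_UN_incseq open_UN) (auto simp: incseq_def, force)
  also have "\<dots> \<le> (\<Sum>n. open_content (U n))"
    by (intro SUP_least order_trans[OF fin] sum_le_suminf) auto
  finally show ?thesis .
qed

lemma outer_open: "open U \<Longrightarrow> outer U = open_content U"
  unfolding outer_def by (intro antisym INF_lower INF_greatest open_content_mono) auto

lemma outer_approx:
  assumes "0 < e" obtains U where "open U" "A \<subseteq> U" "open_content U \<le> outer A + ennreal e"
proof -
  have "outer A \<le> open_content UNIV" unfolding outer_def by (rule INF_lower) auto
  then have "outer A \<noteq> \<infinity>"
    using open_content_less_top[of UNIV] by auto
  then show thesis
    using INF_approx_ennreal[of e "outer A" open_content "{U. open U \<and> A \<subseteq> U}"] assms that
    by (auto simp: outer_def intro: less_imp_le)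
qed

lemma outer_countably_subadditive: "countably_subadditive UNIV outer"
  unfolding countably_subadditive_def
proof (intro allI impI)
  fix A :: "nat \<Rightarrow> 'a set"
  show "outer (\<Union>i. A i) \<le> (\<Sum>i. outer (A i))"
  proof (rule ennreal_le_epsilon)
    fix e :: real assume e: "0 < e"
    have "\<exists>U. open U \<and> A i \<subseteq> U \<and> open_content U \<le> outer (A i) + ennreal (e * (1 / 2) ^ Suc i)" for i
      using outer_approx[of "e * (1/2) ^ Suc i" "A i"] e by auto
    then obtain U where U: "\<And>i. open (U i)" "\<And>i. A i \<subseteq> U i"
      "\<And>i. open_content (U i) \<le> outer (A i) + ennreal (e * (1 / 2) ^ Suc i)"
      by metis
    have sums: "(\<lambda>i. e * (1 / 2) ^ Suc i) sums (e * 1)"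
      by (intro sums_mult power_half_series)
    have "outer (\<Union>i. A i) \<le> open_content (\<Union>i. U i)"
      unfolding outer_def using U by (intro INF_lower) auto
    also have "\<dots> \<le> (\<Sum>i. open_content (U i))" by (intro open_content_UN U)
    also have "\<dots> \<le> (\<Sum>i. outer (A i) + ennreal (e * (1 / 2) ^ Suc i))"
      by (intro suminf_le U) auto
    also have "\<dots> = (\<Sum>i. outer (A i)) + (\<Sum>i. ennreal (e * (1 / 2) ^ Suc i))"
      by (rule suminf_add[symmetric]) auto
    also have "(\<Sum>i. ennreal (e * (1 / 2) ^ Suc i)) = ennreal e"
      by (subst suminf_ennreal_eq[OF _ sums]) (use e in auto)
    finally show "outer (\<Union>i. A i) \<le> (\<Sum>i. outer (A i)) + ennreal e" .
  qed
qed

lemma outer_mono: "A \<subseteq> B \<Longrightarrow> outer A \<le> outer B"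
  unfolding outer_def by (intro INF_superset_mono) auto

lemma outer_measure_space_outer: "outer_measure_space UNIV outer"
  unfolding outer_measure_space_def
  using outer_open[of "{}"] outer_mono outer_countably_subadditive
  by (auto simp: positive_def increasing_def open_content_empty)

lemma outer_Un: "outer (A \<union> B) \<le> outer A + outer B"
proof -
  have "subadditive UNIV outer"
    using outer_countably_subadditive outer_open[of "{}"]
    by (intro ring_of_sets.countably_subadditive_subadditive[where \<Omega> = UNIV])
       (auto simp: positive_def open_content_empty ring_of_sets_iff)
  have "outer (A \<union> B) = outer (A \<union> (B - A))" by simp
  also have "\<dots> \<le> outer A + outer (B - A)"
    by (rule subadditiveD[OF \<open>subadditive UNIV outer\<close>]) auto
  also have "\<dots> \<le> outer A + outer B" by (intro add_left_mono outer_mono) auto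
  finally show ?thesis .
qed

text \<open>
  Let \<open>f\<close> be a test function for \<open>U \<inter> W\<close> with \<open>W\<close> open. Removing the compact set \<open>{e \<le> f}\<close> from \<open>W\<close> leaves an
  open set that contains \<open>W - U\<close>, and its test functions may be added to \<open>max 0 (f - e)\<close> without
  exceeding the indicator of \<open>W\<close>.
\<close>

lemma open_Caratheodory_measurable:
  assumes "open U" shows "U \<in> lambda_system UNIV UNIV outer"
proof -
  have "outer (U \<inter> X) + outer ((UNIV - U) \<inter> X) \<le> outer X" for X
  proof (rule ennreal_le_epsilon)
    fix e :: real assume e: "0 < e"
    obtain W where W: "open W" "X \<subseteq> W" "open_content W \<le> outer X + ennreal e"
      by (rule outer_approx[OF e])
    have "outer (U \<inter> X) + outer ((UNIV - U) \<inter> X) \<le> open_content (U \<inter> W) + outer (W - U)"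
    proof (intro add_mono)
      show "outer (U \<inter> X) \<le> open_content (U \<inter> W)"
        unfolding outer_def using W assms by (intro INF_lower) auto
      show "outer ((UNIV - U) \<inter> X) \<le> outer (W - U)"
        using W(2) by (intro outer_mono) auto
    qed
    also have "\<dots> \<le> open_content W"
    proof (rule open_content_add_le_truncated)
      fix f :: "'a \<Rightarrow> real" and e :: real
      assume f: "f \<in> Cc_funs" "\<And>x. 0 \<le> f x" "\<And>x. f x \<le> indicator (U \<inter> W) x" and e: "0 < e"
      define C where "C = {x. e \<le> f x}"
      have "compact C" unfolding C_def using f(1) e by (rule compact_superlevel)
      have CU: "C \<subseteq> U"
      proof
        fix x assume "x \<in> C"
        then show "x \<in> U"
          using f(3)[of x] e by (cases "x \<in> U \<inter> W") (auto simp: C_def)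
      qed
      define h where "h = (\<lambda>x. max 0 (f x - e))"
      have h: "h \<in> Cc_funs" "\<And>x. 0 \<le> h x"
        using f e by (auto simp: h_def intro!: Cc_funs_pos_part)
      have oWC: "open (W - C)" using W(1) \<open>compact C\<close> by (intro open_Diff compact_imp_closed)
      have "outer (W - U) \<le> open_content (W - C)"
        unfolding outer_def using oWC CU by (intro INF_lower) auto
      moreover have "open_content (W - C) + ennreal (I h) \<le> open_content W"
      proof (rule open_content_add_le_truncated)
        fix g :: "'a \<Rightarrow> real" and e' :: real
        assume g0: "g \<in> Cc_funs" "\<And>x. 0 \<le> g x" "\<And>x. g x \<le> indicator (W - C) x" and e': "0 < e'"
        define k where "k = (\<lambda>x. max 0 (g x - e'))"
        have k: "k \<in> Cc_funs" "\<And>x. 0 \<le> k x" "\<And>x. k x \<le> g x"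
          using g0 e' by (auto simp: k_def intro!: Cc_funs_pos_part)
        have "ennreal (I k) + ennreal (I h) = ennreal (I (\<lambda>x. k x + h x))"
          using add[OF k(1) h(1)] nonneg[OF k(1,2)] nonneg[OF h] by simp
        also have "\<dots> \<le> open_content W"
        proof (intro open_content_ge)
          show "k x + h x \<le> indicator W x" for x
          proof (cases "x \<in> C")
            case True
            then have "k x \<le> 0" using k(3)[of x] g0(3)[of x] by simp
            moreover have "h x \<le> f x" using f(2)[of x] e by (simp add: h_def)
            ultimately show ?thesis
              using f(3)[of x] by (cases "x \<in> U"; cases "x \<in> W") auto
          next
            case False
            then have "h x = 0" by (simp add: h_def C_def)
            then show ?thesis using k(3)[of x] g0(3)[of x] False by (cases "x \<in> W") auto
          qed
        qed (use k h in \<open>auto intro: Cc_funs_add add_nonneg_nonneg\<close>)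
        finally show "ennreal (I (\<lambda>x. max 0 (g x - e'))) + ennreal (I h) \<le> open_content W"
          by (simp add: k_def)
      qed
      ultimately have "outer (W - U) + ennreal (I h) \<le> open_content W"
        by (rule order_trans[OF add_right_mono])
      then show "ennreal (I (\<lambda>x. max 0 (f x - e))) + outer (W - U) \<le> open_content W"
        by (simp add: h_def add.commute)
    qed
    also note W(3)
    finally show "outer (U \<inter> X) + outer ((UNIV - U) \<inter> X) \<le> outer X + ennreal e" .
  qed
  moreover have "outer X \<le> outer (U \<inter> X) + outer ((UNIV - U) \<inter> X)" for X
    using outer_Un[of "U \<inter> X" "(UNIV - U) \<inter> X"] by (simp add: Int_Un_distrib2[symmetric])
  ultimately show ?thesis by (auto simp: lambda_system_def intro!: antisym)
qed

lemma ex_representing_measure_of_open_content: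
  "\<exists>\<mu>. sets \<mu> = sets borel \<and> (\<forall>U. open U \<longrightarrow> emeasure \<mu> U = open_content U)"
proof -
  define L where "L = lambda_system UNIV UNIV outer"
  have ms: "measure_space UNIV L outer"
    using sigma_algebra.caratheodory_lemma[OF sigma_algebra_Pow, of UNIV outer] outer_measure_space_outer
    by (simp add: L_def)
  then have "sigma_algebra UNIV L" by (simp add: measure_space_def)
  then have "sigma_sets UNIV {U. open U} \<subseteq> L"
    using open_Caratheodory_measurable by (intro sigma_algebra.sigma_sets_subset) (auto simp: L_def)
  then have ms': "measure_space UNIV (sigma_sets UNIV {U. open U}) outer"
    by (intro measure_down[OF ms] sigma_algebra_sigma_sets) auto
  define \<mu> where "\<mu> = measure_of UNIV {U. open U} outer"
  have "sets \<mu> = sets borel" by (simp add: \<mu>_def borel_def)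
  moreover have "emeasure \<mu> U = open_content U" if "open U" for U
  proof -
    have "emeasure \<mu> U = outer U"
    proof (rule emeasure_measure_of[OF \<mu>_def])
      show "U \<in> sets \<mu>" using that by (simp add: \<mu>_def)
      show "positive (sets \<mu>) outer" "countably_additive (sets \<mu>) outer"
        using ms' by (simp_all add: measure_space_def \<mu>_def)
    qed simp
    then show ?thesis by (simp add: outer_open that)
  qed
  ultimately show ?thesis by blast
qed

end

text \<open>
  The two estimates that determine a functional from the values \<open>\<mu>\<close> of open sets. Both a positive
  functional and the integral of the measure constructed from it satisfy them.
\<close>

locale layered_functional =
  fixes L :: "('a::topological_space \<Rightarrow> real) \<Rightarrow> real" and \<mu> :: "'a set \<Rightarrow> real"
  assumes add: "f \<in> Cc_funs \<Longrightarrow> g \<in> Cc_funs \<Longrightarrow> L (\<lambda>x. f x + g x) = L f + L g"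
    and upper: "f \<in> Cc_funs \<Longrightarrow> 0 < c \<Longrightarrow> (\<And>x. 0 \<le> f x) \<Longrightarrow> (\<And>x. f x \<le> c) \<Longrightarrow>
                  L f \<le> c * \<mu> {x. 0 < f x}"
    and lower: "f \<in> Cc_funs \<Longrightarrow> 0 < c \<Longrightarrow> (\<And>x. 0 \<le> f x) \<Longrightarrow> open V \<Longrightarrow>
                  (\<And>x. x \<in> V \<Longrightarrow> c \<le> f x) \<Longrightarrow> c * \<mu> V \<le> L f"

text \<open>
  Layer cake: \<open>min (f x) (n / N)\<close> grows with \<open>n\<close> by layers of height \<open>1 / N\<close>, and the value of the
  functional at each layer is controlled by the two superlevel sets that bound it.
\<close>

lemma (in layered_functional) layer_bounds:
  assumes f: "f \<in> Cc_funs" "\<And>x. 0 \<le> f x" "\<And>x. f x \<le> 1" and N: "0 < (N::nat)"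
  shows "(\<Sum>j<N. \<mu> {x. real (Suc j) / N < f x}) / N \<le> L f"
    and "L f \<le> (\<Sum>j<N. \<mu> {x. real j / N < f x}) / N"
proof -
  have min_Cc: "(\<lambda>x. min (f x) (real n / N)) \<in> Cc_funs" for n
    using f(1) by (intro Cc_funs_min) auto
  define \<psi> where "\<psi> j x = min (max 0 (f x - real j / N)) (1 / N)" for j x
  have \<psi>: "\<psi> j \<in> Cc_funs" "\<And>x. 0 \<le> \<psi> j x" "\<And>x. \<psi> j x \<le> 1 / N" for j
    unfolding \<psi>_def using f(1) by (auto intro!: Cc_funs_min Cc_funs_pos_part)
  have zero: "L (\<lambda>x. 0) = 0" using add[OF Cc_funs_zero Cc_funs_zero] by simp
  have "(\<Sum>j<n. \<mu> {x. real (Suc j) / N < f x}) / N \<le> L (\<lambda>x. min (f x) (real n / N)) \<and>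
    L (\<lambda>x. min (f x) (real n / N)) \<le> (\<Sum>j<n. \<mu> {x. real j / N < f x}) / N" for n
  proof (induction n)
    case 0
    have "(\<lambda>x. min (f x) (real 0 / N)) = (\<lambda>x. 0)" using f(2) by (intro ext) (simp add: min_absorb2)
    then show ?case by (simp add: zero)
  next
    case (Suc n)
    have split: "min t (a + b) = min t a + min (max 0 (t - a)) b" if "0 < b" for t a b :: real
      using that by auto
    have "real (Suc n) / N = real n / N + 1 / N" by (simp add: add_divide_distrib)
    then have "min (f x) (real (Suc n) / N) = min (f x) (real n / N) + \<psi> n x" for x
      using N by (simp add: \<psi>_def split)
    then have step: "L (\<lambda>x. min (f x) (real (Suc n) / N)) = L (\<lambda>x. min (f x) (real n / N)) + L (\<psi> n)"
      using add[OF min_Cc \<psi>(1)] by simp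
    have pos: "{x. 0 < \<psi> n x} = {x. real n / N < f x}"
      using N by (auto simp: \<psi>_def)
    have "L (\<psi> n) \<le> 1 / N * \<mu> {x. real n / N < f x}"
      using upper[OF \<psi>(1)[of n], of "1 / N"] N \<psi> by (simp add: pos)
    moreover have "1 / N * \<mu> {x. real (Suc n) / N < f x} \<le> L (\<psi> n)"
    proof (rule lower)
      show "open {x. real (Suc n) / N < f x}"
        using Cc_funs_continuous[OF f(1)] by (intro open_Collect_less) auto
      show "1 / N \<le> \<psi> n x" if "x \<in> {x. real (Suc n) / N < f x}" for x
        using that N by (auto simp: \<psi>_def add_divide_distrib)
    qed (use \<psi> N in auto)
    ultimately show ?case
      using Suc unfolding step sum.lessThan_Suc add_divide_distrib by simp
  qed
  from this[of N] show "(\<Sum>j<N. \<mu> {x. real (Suc j) / N < f x}) / N \<le> L f"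
    "L f \<le> (\<Sum>j<N. \<mu> {x. real j / N < f x}) / N"
    using N f(3) by (simp_all add: min_absorb1)
qed

text \<open>
  Both values lie between two sums whose difference telescopes to a quantity of order \<open>1 / N\<close>.
\<close>

lemma layered_functional_unique:
  assumes L: "layered_functional L \<mu>" and L': "layered_functional L' \<mu>"
    and f: "f \<in> Cc_funs" "\<And>x. 0 \<le> f x" "\<And>x. f x \<le> 1"
  shows "L f = L' f"
proof -
  define D where "D = \<mu> {x. 0 < f x} - \<mu> {x. 1 < f x}"
  have bd: "\<bar>L f - L' f\<bar> \<le> D / real N" if N: "0 < N" for N
  proof -
    have "(\<Sum>j<N. \<mu> {x. real j / N < f x}) / N - (\<Sum>j<N. \<mu> {x. real (Suc j) / N < f x}) / N
        = (\<Sum>j<N. \<mu> {x. real j / N < f x} - \<mu> {x. real (Suc j) / N < f x}) / N"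
      by (simp add: sum_subtractf diff_divide_distrib)
    also have "\<dots> = D / N"
      using N sum_lessThan_telescope'[of "\<lambda>j. \<mu> {x. real j / N < f x}" N] by (simp add: D_def)
    finally show ?thesis
      using layered_functional.layer_bounds[OF L f N] layered_functional.layer_bounds[OF L' f N]
      by linarith
  qed
  have "(\<lambda>N. D / real (Suc N)) \<longlonglongrightarrow> 0"
    by (rule LIMSEQ_Suc[OF lim_const_over_n])
  then have "\<bar>L f - L' f\<bar> \<le> 0"
    by (rule LIMSEQ_le_const) (use bd[of "Suc _"] in blast)
  then show ?thesis by simp
qed

text \<open>
  The integral agrees with the functional because both are layered over the contents of open sets.
\<close>

theorem (in bounded_positive_functional) riesz_representation:
  "\<exists>\<mu>. sets \<mu> = sets borel \<and> emeasure \<mu> UNIV \<le> ennreal M \<and> (\<forall>f\<in>Cc_funs. integral\<^sup>L \<mu> f = I f)"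
proof -
  obtain \<mu> where \<mu>: "sets \<mu> = sets borel" "\<And>U. open U \<Longrightarrow> emeasure \<mu> U = open_content U"
    using ex_representing_measure_of_open_content by blast
  have space: "space \<mu> = UNIV" using sets_eq_imp_space_eq[OF \<mu>(1)] by simp
  interpret finite_measure \<mu>
    using open_content_less_top[of UNIV] by (intro finite_measureI) (simp add: space \<mu>(2))
  have meas: "measure \<mu> U = enn2real (open_content U)" if "open U" for U
    using \<mu>(2)[OF that] by (simp add: measure_def)
  have ennmeas: "ennreal (measure \<mu> U) = open_content U" if "open U" for U
    using \<mu>(2)[OF that] by (simp add: emeasure_eq_measure)
  have Cc_meas: "f \<in> borel_measurable \<mu>" if "f \<in> Cc_funs" for f
    using borel_measurable_continuous_onI[OF Cc_funs_continuous[OF that]]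
    unfolding measurable_cong_sets[OF \<mu>(1) refl] .
  have Cc_int: "integrable \<mu> f" if f: "f \<in> Cc_funs" for f
  proof -
    obtain B where "\<And>x. \<bar>f x\<bar> \<le> B" using Cc_funs_bounded[OF f] by blast
    then show ?thesis using Cc_meas[OF f] by (intro integrable_const_bound[where B = B]) auto
  qed
  have I1: "I f \<le> c * measure \<mu> {x. 0 < f x}"
    if f: "f \<in> Cc_funs" "0 < c" "\<And>x. 0 \<le> f x" "\<And>x. f x \<le> c" for f c
  proof -
    have op: "open {x. 0 < f x}"
      using Cc_funs_continuous[OF f(1)] by (intro open_Collect_less) auto
    have "ennreal (I (\<lambda>x. (1 / c) * f x)) \<le> open_content {x. 0 < f x}"
    proof (intro open_content_ge Cc_funs_scale f(1))
      show "0 \<le> 1 / c * f x" "1 / c * f x \<le> indicator {x. 0 < f x} x" for x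
        using f(2) f(3)[of x] f(4)[of x] by (auto simp: indicator_def field_simps)
    qed
    then have "1 / c * I f \<le> measure \<mu> {x. 0 < f x}"
      unfolding scale[OF f(1)] ennmeas[OF op, symmetric] by (subst (asm) ennreal_le_iff) auto
    then show ?thesis using f(2) by (simp add: field_simps)
  qed
  have I2: "c * measure \<mu> V \<le> I f"
    if f: "f \<in> Cc_funs" "0 < c" "\<And>x. 0 \<le> f x" "open V" "\<And>x. x \<in> V \<Longrightarrow> c \<le> f x" for f c V
  proof -
    have "open_content V \<le> ennreal (I f / c)"
    proof (rule open_content_le, rule ennreal_leI)
      fix g assume g: "g \<in> Cc_funs" "\<And>x. 0 \<le> g x" "\<And>x. g x \<le> indicator V x"
      have "I (\<lambda>x. c * g x) \<le> I f"
      proof (intro I_mono Cc_funs_scale g(1) f(1))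
        show "c * g x \<le> f x" for x
        proof (cases "x \<in> V")
          case True
          then have "c * g x \<le> c * 1" using g(3)[of x] f(2) by (intro mult_left_mono) auto
          then show ?thesis using f(5)[OF True] by simp
        next
          case False
          then have "g x = 0" using g(2,3)[of x] by simp
          then show ?thesis using f(3) by simp
        qed
      qed
      then show "I g \<le> I f / c" using f(2) by (simp add: scale[OF g(1)] field_simps)
    qed
    then have "measure \<mu> V \<le> I f / c"
      unfolding ennmeas[OF f(4), symmetric]
      using f(2) nonneg[OF f(1,3)] by (subst (asm) ennreal_le_iff) auto
    then show ?thesis using f(2) by (simp add: field_simps)
  qed
  have L1: "integral\<^sup>L \<mu> f \<le> c * measure \<mu> {x. 0 < f x}"
    if f: "f \<in> Cc_funs" "0 < c" "\<And>x. 0 \<le> f x" "\<And>x. f x \<le> c" for f c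
  proof -
    have op: "open {x. 0 < f x}"
      using Cc_funs_continuous[OF f(1)] by (intro open_Collect_less) auto
    have "integral\<^sup>L \<mu> f \<le> integral\<^sup>L \<mu> (\<lambda>x. c * indicator {x. 0 < f x} x)"
    proof (rule integral_mono)
      have "integrable \<mu> (indicator {x. 0 < f x} :: 'a \<Rightarrow> real)"
        using op \<mu>(1) by (intro integrable_real_indicator) (auto simp: less_top[symmetric])
      then show "integrable \<mu> (\<lambda>x. c * indicator {x. 0 < f x} x)" by simp
      show "f x \<le> c * indicator {x. 0 < f x} x" for x
        using f(4) by (auto simp: indicator_def not_less)
    qed (rule Cc_int[OF f(1)])
    then show ?thesis using op \<mu>(1) by simp
  qed
  have L2: "c * measure \<mu> V \<le> integral\<^sup>L \<mu> f"
    if f: "f \<in> Cc_funs" "0 < c" "\<And>x. 0 \<le> f x" "open V" "\<And>x. x \<in> V \<Longrightarrow> c \<le> f x" for f c V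
  proof -
    have "integral\<^sup>L \<mu> (\<lambda>x. c * indicator V x) \<le> integral\<^sup>L \<mu> f"
    proof (rule integral_mono)
      have "integrable \<mu> (indicator V :: 'a \<Rightarrow> real)"
        using f(4) \<mu>(1) by (intro integrable_real_indicator) (auto simp: less_top[symmetric])
      then show "integrable \<mu> (\<lambda>x. c * indicator V x)" by simp
      show "c * indicator V x \<le> f x" for x
        using f(3,5) by (auto simp: indicator_def)
    qed (rule Cc_int[OF f(1)])
    then show ?thesis using f \<mu>(1) by simp
  qed
  have L0: "integral\<^sup>L \<mu> (\<lambda>x. f x + g x) = integral\<^sup>L \<mu> f + integral\<^sup>L \<mu> g"
    if "f \<in> Cc_funs" "g \<in> Cc_funs" for f g using Cc_int that by simp
  have unit: "integral\<^sup>L \<mu> f = I f" if "f \<in> Cc_funs" "\<And>x. 0 \<le> f x" "\<And>x. f x \<le> 1" for f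
  proof (rule layered_functional_unique[where \<mu> = "measure \<mu>" and L = "integral\<^sup>L \<mu>" and L' = I])
    show "layered_functional I (measure \<mu>)" by unfold_locales (fact add I1 I2)+
    show "layered_functional (integral\<^sup>L \<mu>) (measure \<mu>)" by unfold_locales (fact L0 L1 L2)+
  qed (fact that)+
  have pos: "integral\<^sup>L \<mu> f = I f" if f: "f \<in> Cc_funs" "\<And>x. 0 \<le> f x" for f
  proof -
    obtain B where B: "0 < B" "\<And>x. \<bar>f x\<bar> \<le> B" using Cc_funs_bounded[OF f(1)] by blast
    have "integral\<^sup>L \<mu> (\<lambda>x. (1 / B) * f x) = I (\<lambda>x. (1 / B) * f x)"
    proof (intro unit Cc_funs_scale f(1))
      show "0 \<le> 1 / B * f x" "1 / B * f x \<le> 1" for x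
        using B f(2)[of x] B(2)[of x] by (auto simp: field_simps)
    qed
    then show ?thesis using B(1) unfolding scale[OF f(1)] by simp
  qed
  have "integral\<^sup>L \<mu> f = I f" if f: "f \<in> Cc_funs" for f
  proof -
    have p: "(\<lambda>x. max 0 (f x - 0)) \<in> Cc_funs" "(\<lambda>x. max 0 ((-1) * f x - 0)) \<in> Cc_funs"
      by (rule Cc_funs_pos_part[OF f]; simp) (rule Cc_funs_pos_part[OF Cc_funs_scale[OF f]]; simp)
    have "(\<lambda>x. f x + max 0 ((-1) * f x - 0)) = (\<lambda>x. max 0 (f x - 0))" by (auto simp: max_def)
    then have "I f + I (\<lambda>x. max 0 ((-1) * f x - 0)) = I (\<lambda>x. max 0 (f x - 0))"
      "integral\<^sup>L \<mu> f + integral\<^sup>L \<mu> (\<lambda>x. max 0 ((-1) * f x - 0)) = integral\<^sup>L \<mu> (\<lambda>x. max 0 (f x - 0))"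
      using add[OF f p(2)] L0[OF f p(2)] by simp_all
    then show ?thesis using pos[OF p(1)] pos[OF p(2)] by simp
  qed
  moreover have "emeasure \<mu> UNIV \<le> ennreal M" using open_content_UNIV by (simp add: \<mu>(2))
  ultimately show ?thesis using \<mu>(1) by blast
qed

section \<open>Signed powers\<close>

text \<open>
  For \<open>a = p - 1\<close> this is the derivative of \<open>\<bar>s\<bar> powr p\<close> divided by \<open>p\<close>, usually written
  \<open>\<bar>s\<bar>\<^sup>p\<^sup>-\<^sup>2 s\<close>; the sign makes it well defined at \<open>s = 0\<close> also when \<open>p < 2\<close>.
\<close>

definition signed_powr :: "real \<Rightarrow> real \<Rightarrow> real" where
  "signed_powr a s = sgn s * \<bar>s\<bar> powr a"

lemma abs_signed_powr: "\<bar>signed_powr a s\<bar> = \<bar>s\<bar> powr a"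
  by (cases "s = 0") (auto simp: signed_powr_def abs_mult)

lemma signed_powr_mult_self: "signed_powr (a - 1) s * s = \<bar>s\<bar> powr a"
proof (cases "s = 0")
  case False
  have "signed_powr (a - 1) s * s = \<bar>s\<bar> powr (a - 1) * \<bar>s\<bar> powr 1"
    using False by (simp add: signed_powr_def sgn_if)
  also have "\<dots> = \<bar>s\<bar> powr a" by (subst powr_add[symmetric]) simp
  finally show ?thesis .
qed (simp add: signed_powr_def)

lemma signed_powr_mult: "signed_powr a (s * t) = signed_powr a s * signed_powr a t"
  by (simp add: signed_powr_def sgn_mult abs_mult powr_mult ac_simps)

lemma signed_powr_of_nonneg: "0 \<le> s \<Longrightarrow> signed_powr a s = s powr a"
  by (cases "s = 0") (auto simp: signed_powr_def)

lemma signed_powr_inverse: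
  assumes "a * b = 1" shows "signed_powr a (signed_powr b s) = s"
proof (cases "s = 0")
  case False
  then have "0 < \<bar>s\<bar> powr b" by simp
  then have "sgn (signed_powr b s) = sgn s"
    unfolding signed_powr_def by (simp add: sgn_mult)
  moreover have "\<bar>signed_powr b s\<bar> powr a = \<bar>s\<bar>"
    using assms by (simp add: abs_signed_powr powr_powr mult.commute)
  ultimately show ?thesis by (simp add: signed_powr_def[of a] sgn_mult_abs)
qed (simp add: signed_powr_def)

text \<open>
  In this form continuity at \<open>0\<close> follows from that of powers of nonnegative functions.
\<close>

lemma signed_powr_eq_pos_part_diff:
  "signed_powr a s = max 0 s powr a - max 0 (- s) powr a"
  by (cases s "0 :: real" rule: linorder_cases) (auto simp: signed_powr_def)

lemma continuous_signed_powr: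
  assumes "0 < a" shows "continuous_on S (signed_powr a)"
  unfolding signed_powr_eq_pos_part_diff[abs_def]
  using assms by (intro continuous_intros continuous_on_powr') auto

lemma has_real_derivative_abs_powr:
  assumes p: "1 < p"
  shows "((\<lambda>s. \<bar>s\<bar> powr p) has_real_derivative p * signed_powr (p - 1) s) (at s)"
proof (cases s "0 :: real" rule: linorder_cases)
  case greater
  have "((\<lambda>s. s powr p) has_real_derivative p * s powr (p - 1)) (at s)"
    using greater by (auto intro!: derivative_eq_intros)
  then have "((\<lambda>s. \<bar>s\<bar> powr p) has_real_derivative p * s powr (p - 1)) (at s)"
    by (rule has_field_derivative_transform_within_open[where S = "{0<..}"]) (use greater in auto)
  then show ?thesis using greater by (simp add: signed_powr_def)
next
  case less
  have "((\<lambda>s. (- s) powr p) has_real_derivative p * (- ((- s) powr (p - 1)))) (at s)"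
    using less by (auto intro!: derivative_eq_intros)
  then have "((\<lambda>s. \<bar>s\<bar> powr p) has_real_derivative p * (- ((- s) powr (p - 1)))) (at s)"
    by (rule has_field_derivative_transform_within_open[where S = "{..<0}"]) (use less in auto)
  then show ?thesis using less by (simp add: signed_powr_def)
next
  case equal
  have "isCont (signed_powr (p - 1)) 0"
    using continuous_signed_powr[of "p - 1" UNIV] p by (simp add: continuous_on_eq_continuous_at)
  then have "(signed_powr (p - 1) \<longlongrightarrow> 0) (at 0)"
    by (simp add: isCont_def signed_powr_def)
  \<comment> \<open>The difference quotient at 0 is the signed power itself.\<close>
  moreover have "signed_powr (p - 1) h = \<bar>h\<bar> powr p / h" if "h \<noteq> 0" for h
    using signed_powr_mult_self[of p h] that by (simp add: field_simps)
  ultimately have "((\<lambda>h. \<bar>h\<bar> powr p / h) \<longlongrightarrow> 0) (at 0)"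
    by (subst tendsto_cong[of _ "signed_powr (p - 1)"]) (auto simp: eventually_at_filter)
  then show ?thesis using equal by (simp add: DERIV_def signed_powr_def)
qed

lemma abs_powr_mean_value:
  assumes p: "1 < p"
  obtains \<xi> where "min x y \<le> \<xi>" "\<xi> \<le> max x y"
    "\<bar>x\<bar> powr p - \<bar>y\<bar> powr p = p * signed_powr (p - 1) \<xi> * (x - y)"
proof -
  have *: "\<exists>\<xi>. x \<le> \<xi> \<and> \<xi> \<le> y \<and> \<bar>y\<bar> powr p - \<bar>x\<bar> powr p = p * signed_powr (p - 1) \<xi> * (y - x)"
    if xy: "x < y" for x y
  proof -
    obtain \<xi> where "x < \<xi>" "\<xi> < y" "\<bar>y\<bar> powr p - \<bar>x\<bar> powr p = (y - x) * (p * signed_powr (p - 1) \<xi>)"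
      using MVT2[OF xy, of "\<lambda>s. \<bar>s\<bar> powr p" "\<lambda>s. p * signed_powr (p - 1) s"]
        has_real_derivative_abs_powr[OF p] by metis
    then show ?thesis by (intro exI[of _ \<xi>]) (simp add: mult.commute)
  qed
  show thesis
  proof (cases x y rule: linorder_cases)
    case less
    from *[OF this] that show thesis by (auto simp: algebra_simps)
  next
    case equal
    with that[of x] show thesis by simp
  next
    case greater
    from *[OF this] that show thesis by auto
  qed
qed

lemma powr_add_le:
  fixes x y :: real assumes "0 \<le> p"
  shows "\<bar>x + y\<bar> powr p \<le> 2 powr p * (\<bar>x\<bar> powr p + \<bar>y\<bar> powr p)"
proof -
  have "\<bar>x + y\<bar> powr p \<le> (2 * max \<bar>x\<bar> \<bar>y\<bar>) powr p"
    using assms by (intro powr_mono2) auto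
  also have "\<dots> = 2 powr p * max \<bar>x\<bar> \<bar>y\<bar> powr p" by (simp add: powr_mult)
  also have "\<dots> \<le> 2 powr p * (\<bar>x\<bar> powr p + \<bar>y\<bar> powr p)"
    by (intro mult_left_mono) (auto simp: max_def)
  finally show ?thesis .
qed

lemma signed_powr_mult_le:
  fixes x y :: real assumes "1 < p"
  shows "\<bar>signed_powr (p - 1) x * y\<bar> \<le> \<bar>x\<bar> powr p + \<bar>y\<bar> powr p"
proof -
  define M where "M = max \<bar>x\<bar> \<bar>y\<bar>"
  have "\<bar>signed_powr (p - 1) x * y\<bar> = \<bar>x\<bar> powr (p - 1) * \<bar>y\<bar>" by (simp add: abs_mult abs_signed_powr)
  also have "\<dots> \<le> M powr (p - 1) * M"
    using assms by (intro mult_mono powr_mono2) (auto simp: M_def)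
  also have "\<dots> = M powr p"
    using signed_powr_mult_self[of p M] by (simp add: M_def signed_powr_of_nonneg)
  also have "\<dots> \<le> \<bar>x\<bar> powr p + \<bar>y\<bar> powr p" by (auto simp: M_def max_def)
  finally show ?thesis .
qed

text \<open>
  Both sides are homogeneous of degree \<open>p\<close> in \<open>(a, b)\<close>. Dividing by \<open>max \<bar>a\<bar> \<bar>b\<bar>\<close> reduces the estimate to the
  uniform continuity of the signed power on a compact interval, which treats \<open>p < 2\<close> and \<open>2 \<le> p\<close> alike.
  This replaces the usual Clarkson type inequalities.
\<close>

lemma abs_powr_uniformly_differentiable:
  assumes p: "1 < p" and \<epsilon>: "0 < \<epsilon>"
  obtains \<delta> where "0 < \<delta>"
    "\<And>a b t :: real. \<bar>t\<bar> \<le> \<delta> \<Longrightarrow>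
       \<bar>\<bar>a + t * b\<bar> powr p - \<bar>a\<bar> powr p - t * (p * (signed_powr (p - 1) a * b))\<bar>
         \<le> \<epsilon> * \<bar>t\<bar> * (\<bar>a\<bar> powr p + \<bar>b\<bar> powr p)"
proof -
  have "uniformly_continuous_on {-2..2} (signed_powr (p - 1))"
    using p by (intro compact_uniformly_continuous continuous_signed_powr) auto
  moreover have "0 < \<epsilon> / p" using p \<epsilon> by simp
  ultimately obtain d where d: "0 < d" "\<And>x y. x \<in> {-2..2} \<Longrightarrow> y \<in> {-2..2} \<Longrightarrow> dist y x < d \<Longrightarrow>
      dist (signed_powr (p - 1) y) (signed_powr (p - 1) x) < \<epsilon> / p"
    by (rule uniformly_continuous_onE) blast
  show thesis
  proof (rule that[of "min 1 (d / 2)"])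
    show "0 < min 1 (d / 2)" using d by simp
    fix a b t :: real assume t: "\<bar>t\<bar> \<le> min 1 (d / 2)"
    define M where "M = max \<bar>a\<bar> \<bar>b\<bar>"
    show "\<bar>\<bar>a + t * b\<bar> powr p - \<bar>a\<bar> powr p - t * (p * (signed_powr (p - 1) a * b))\<bar>
         \<le> \<epsilon> * \<bar>t\<bar> * (\<bar>a\<bar> powr p + \<bar>b\<bar> powr p)"
    proof (cases "M = 0")
      case True
      then show ?thesis by (auto simp: M_def max_def split: if_splits)
    next
      case False
      then have M: "0 < M" by (auto simp: M_def)
      obtain \<xi> where \<xi>: "min (a + t * b) a \<le> \<xi>" "\<xi> \<le> max (a + t * b) a"
        "\<bar>a + t * b\<bar> powr p - \<bar>a\<bar> powr p = p * signed_powr (p - 1) \<xi> * (a + t * b - a)"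
        by (rule abs_powr_mean_value[OF p])
      have tb: "\<bar>t * b\<bar> \<le> \<bar>t\<bar> * M" unfolding abs_mult by (intro mult_left_mono) (auto simp: M_def)
      have close: "\<bar>\<xi> - a\<bar> \<le> \<bar>t\<bar> * M" using \<xi>(1,2) tb by linarith
      have "\<bar>t\<bar> * M \<le> 1 * M" using t M by (intro mult_right_mono) auto
      moreover have "\<bar>a\<bar> \<le> M" by (simp add: M_def)
      ultimately have "\<bar>\<xi>\<bar> \<le> 2 * M" "\<bar>a\<bar> \<le> 2 * M" using close M by linarith+
      then have "\<xi> / M \<in> {-2..2}" "a / M \<in> {-2..2}" using M by (auto simp: field_simps abs_le_iff)
      moreover have "dist (\<xi> / M) (a / M) < d"
      proof -
        have "dist (\<xi> / M) (a / M) = \<bar>\<xi> - a\<bar> / M"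
          using M by (simp add: dist_real_def diff_divide_distrib[symmetric])
        also have "\<dots> \<le> \<bar>t\<bar>" using close M by (simp add: field_simps)
        finally show ?thesis using t d(1) by linarith
      qed
      ultimately have "\<bar>signed_powr (p - 1) (\<xi> / M) - signed_powr (p - 1) (a / M)\<bar> < \<epsilon> / p"
        using d(2) by (simp add: dist_real_def)
      moreover have scale: "signed_powr (p - 1) x = M powr (p - 1) * signed_powr (p - 1) (x / M)" for x
        using signed_powr_mult[of "p - 1" M "x / M"] M by (simp add: signed_powr_of_nonneg)
      have "\<bar>signed_powr (p - 1) \<xi> - signed_powr (p - 1) a\<bar>
          = M powr (p - 1) * \<bar>signed_powr (p - 1) (\<xi> / M) - signed_powr (p - 1) (a / M)\<bar>"
        unfolding scale[of \<xi>] scale[of a] by (simp add: abs_mult right_diff_distrib[symmetric])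
      ultimately have diff: "\<bar>signed_powr (p - 1) \<xi> - signed_powr (p - 1) a\<bar> \<le> M powr (p - 1) * (\<epsilon> / p)"
        by (simp add: mult_left_mono del: times_divide_eq_right)
      have "\<bar>\<bar>a + t * b\<bar> powr p - \<bar>a\<bar> powr p - t * (p * (signed_powr (p - 1) a * b))\<bar>
          = p * (\<bar>t * b\<bar> * \<bar>signed_powr (p - 1) \<xi> - signed_powr (p - 1) a\<bar>)"
      proof -
        have "\<bar>a + t * b\<bar> powr p - \<bar>a\<bar> powr p - t * (p * (signed_powr (p - 1) a * b))
          = p * ((t * b) * (signed_powr (p - 1) \<xi> - signed_powr (p - 1) a))"
          unfolding \<xi>(3) by (simp add: algebra_simps)
        then show ?thesis using p by (simp add: abs_mult)
      qed
      also have "\<dots> \<le> p * ((\<bar>t\<bar> * M) * (M powr (p - 1) * (\<epsilon> / p)))"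
        using p by (intro mult_left_mono mult_mono tb diff) (use M in auto)
      also have "\<dots> = \<epsilon> * \<bar>t\<bar> * (M powr (p - 1) * M)" using p by simp
      also have "M powr (p - 1) * M = M powr p"
        using signed_powr_mult_self[of p M] M by (simp add: signed_powr_of_nonneg)
      also have "\<epsilon> * \<bar>t\<bar> * M powr p \<le> \<epsilon> * \<bar>t\<bar> * (\<bar>a\<bar> powr p + \<bar>b\<bar> powr p)"
        using \<epsilon> by (intro mult_left_mono) (auto simp: M_def max_def)
      finally show ?thesis .
    qed
  qed
qed

text \<open>
  With \<open>q = p / (p - 1)\<close> one has \<open>(p - 1) * (q - 1) = 1\<close>, so the mean value theorem for \<open>\<bar>s\<bar> powr q\<close>
  turns the signed power of \<open>\<bar>x\<bar> powr q - \<bar>y\<bar> powr q\<close> into \<open>\<xi>\<close> times the signed power of \<open>x - y\<close>, up to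
  the constant. The whole expression is then the signed power of \<open>x - y\<close> times \<open>(y - \<xi>) * (s - t)\<close>, and
  \<open>\<bar>y - \<xi>\<bar> \<le> \<bar>x - y\<bar>\<close>.
\<close>

lemma signed_powr_chain_rule_error:
  fixes x y s t :: real
  assumes p: "1 < p"
  shows "\<bar>signed_powr (p - 1) (x - y) * (x * s - y * t)
      - ((p - 1) / p) powr (p - 1) *
          (signed_powr (p - 1) (\<bar>x\<bar> powr (p / (p - 1)) - \<bar>y\<bar> powr (p / (p - 1))) * (s - t))
      - s * \<bar>x - y\<bar> powr p\<bar> \<le> \<bar>x - y\<bar> powr p * \<bar>s - t\<bar>"
proof -
  define q where "q = p / (p - 1)"
  have q: "1 < q" "(p - 1) * (q - 1) = 1" using p by (auto simp: q_def field_simps)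
  obtain \<xi> where \<xi>: "min x y \<le> \<xi>" "\<xi> \<le> max x y"
    "\<bar>x\<bar> powr q - \<bar>y\<bar> powr q = q * signed_powr (q - 1) \<xi> * (x - y)"
    by (rule abs_powr_mean_value[OF q(1)])
  have "signed_powr (p - 1) (\<bar>x\<bar> powr q - \<bar>y\<bar> powr q)
      = q powr (p - 1) * (\<xi> * signed_powr (p - 1) (x - y))"
    unfolding \<xi>(3) signed_powr_mult signed_powr_inverse[OF q(2)]
    using q by (simp add: signed_powr_of_nonneg)
  moreover have "((p - 1) / p) powr (p - 1) * q powr (p - 1) = 1"
    using p by (subst powr_mult[symmetric]) (auto simp: q_def)
  ultimately have chain: "((p - 1) / p) powr (p - 1) * signed_powr (p - 1) (\<bar>x\<bar> powr q - \<bar>y\<bar> powr q)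
      = \<xi> * signed_powr (p - 1) (x - y)"
    by (simp add: mult.assoc[symmetric])
  have "signed_powr (p - 1) (x - y) * (x * s - y * t)
      - ((p - 1) / p) powr (p - 1) * (signed_powr (p - 1) (\<bar>x\<bar> powr q - \<bar>y\<bar> powr q) * (s - t))
      - s * \<bar>x - y\<bar> powr p
      = signed_powr (p - 1) (x - y) * (x * s - y * t) - \<xi> * signed_powr (p - 1) (x - y) * (s - t)
       - s * (signed_powr (p - 1) (x - y) * (x - y))"
    unfolding mult.assoc[symmetric] chain signed_powr_mult_self
      by (simp add: signed_powr_mult_self mult.assoc)
  also have "\<dots> = signed_powr (p - 1) (x - y) * (y - \<xi>) * (s - t)"
    by (simp add: algebra_simps)
  finally have "\<bar>signed_powr (p - 1) (x - y) * (x * s - y * t)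
      - ((p - 1) / p) powr (p - 1) * (signed_powr (p - 1) (\<bar>x\<bar> powr q - \<bar>y\<bar> powr q) * (s - t))
      - s * \<bar>x - y\<bar> powr p\<bar> = (\<bar>signed_powr (p - 1) (x - y)\<bar> * \<bar>y - \<xi>\<bar>) * \<bar>s - t\<bar>"
    by (simp add: abs_mult)
  also have "\<dots> \<le> (\<bar>signed_powr (p - 1) (x - y)\<bar> * \<bar>x - y\<bar>) * \<bar>s - t\<bar>"
    using \<xi>(1,2) by (intro mult_right_mono mult_left_mono) auto
  also have "\<bar>signed_powr (p - 1) (x - y)\<bar> * \<bar>x - y\<bar> = \<bar>x - y\<bar> powr p"
    unfolding abs_mult[symmetric] signed_powr_mult_self by simp
  finally show ?thesis by (simp add: q_def)
qed

lemma abs_powr_lipschitz: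
  fixes x y C q :: real
  assumes q: "1 < q" and "\<bar>x\<bar> \<le> C" "\<bar>y\<bar> \<le> C"
  shows "\<bar>\<bar>x\<bar> powr q - \<bar>y\<bar> powr q\<bar> \<le> q * C powr (q - 1) * \<bar>x - y\<bar>"
proof -
  obtain \<xi> where \<xi>: "min x y \<le> \<xi>" "\<xi> \<le> max x y"
    "\<bar>x\<bar> powr q - \<bar>y\<bar> powr q = q * signed_powr (q - 1) \<xi> * (x - y)"
    by (rule abs_powr_mean_value[OF q])
  have "\<bar>\<xi>\<bar> \<le> C" using \<xi>(1,2) assms(2,3) by linarith
  then have "\<bar>\<xi>\<bar> powr (q - 1) \<le> C powr (q - 1)" using q by (intro powr_mono2) auto
  then show ?thesis
    using q unfolding \<xi>(3) abs_mult abs_signed_powr by (intro mult_mono) auto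
qed

section \<open>Derivatives of limits\<close>

text \<open>
  The difference quotient at one fixed small \<open>t\<close> converges and is uniformly close to \<open>D n\<close>, so \<open>D\<close> is
  Cauchy; letting \<open>n\<close> tend to infinity in the uniform estimate identifies the limit.
\<close>

lemma limit_of_derivatives:
  fixes F :: "nat \<Rightarrow> real \<Rightarrow> real" and D :: "nat \<Rightarrow> real"
  assumes lim: "\<And>t. (\<lambda>n. F n t) \<longlonglongrightarrow> G t"
    and unif: "\<And>\<epsilon>. 0 < \<epsilon> \<Longrightarrow> \<exists>\<delta>>0. \<forall>n t. \<bar>t\<bar> \<le> \<delta> \<longrightarrow> \<bar>F n t - F n 0 - t * D n\<bar> \<le> \<epsilon> * \<bar>t\<bar>"
  shows "D \<longlonglongrightarrow> deriv G 0"
proof -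
  have "Cauchy D"
  proof (rule metric_CauchyI)
    fix e :: real assume e: "0 < e"
    obtain \<delta> where \<delta>: "0 < \<delta>" "\<And>n t. \<bar>t\<bar> \<le> \<delta> \<Longrightarrow> \<bar>F n t - F n 0 - t * D n\<bar> \<le> e / 4 * \<bar>t\<bar>"
      using unif[of "e / 4"] e by auto
    define Q where "Q n = (F n \<delta> - F n 0) / \<delta>" for n
    have QD: "\<bar>Q n - D n\<bar> \<le> e / 4" for n
    proof -
      have "Q n - D n = (F n \<delta> - F n 0 - \<delta> * D n) / \<delta>"
        using \<delta>(1) by (simp add: Q_def diff_divide_distrib)
      then have "\<bar>Q n - D n\<bar> = \<bar>F n \<delta> - F n 0 - \<delta> * D n\<bar> / \<delta>"
        using \<delta>(1) by simp
      also have "\<dots> \<le> e / 4" using \<delta>(2)[of \<delta> n] \<delta>(1) by (simp add: pos_divide_le_eq)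
      finally show ?thesis .
    qed
    have "convergent Q" unfolding Q_def convergent_def
      using tendsto_divide[OF tendsto_diff[OF lim[of \<delta>] lim[of 0]] tendsto_const[of \<delta>]] \<delta>(1) by auto
    then have "Cauchy Q" by (rule convergent_Cauchy)
    then obtain N where N: "\<And>m n. m \<ge> N \<Longrightarrow> n \<ge> N \<Longrightarrow> dist (Q m) (Q n) < e / 4"
      using metric_CauchyD[of Q "e / 4"] e by auto
    have "dist (D m) (D n) < e" if "m \<ge> N" "n \<ge> N" for m n
      using QD[of m] QD[of n] N[OF that] e unfolding dist_real_def by linarith
    then show "\<exists>N. \<forall>m\<ge>N. \<forall>n\<ge>N. dist (D m) (D n) < e" by blast
  qed
  then obtain D' where D': "D \<longlonglongrightarrow> D'" using Cauchy_convergent convergentD by blast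
  have "(G has_real_derivative D') (at 0)"
    unfolding DERIV_def
  proof (rule LIM_I)
    fix e :: real assume e: "0 < e"
    obtain \<delta> where \<delta>: "0 < \<delta>" "\<And>n t. \<bar>t\<bar> \<le> \<delta> \<Longrightarrow> \<bar>F n t - F n 0 - t * D n\<bar> \<le> e / 2 * \<bar>t\<bar>"
      using unif[of "e / 2"] e by auto
    have "norm ((G (0 + h) - G 0) / h - D') < e" if h: "h \<noteq> 0 \<and> norm (h - 0) < \<delta>" for h
    proof -
      have "(\<lambda>n. \<bar>F n h - F n 0 - h * D n\<bar>) \<longlonglongrightarrow> \<bar>G h - G 0 - h * D'\<bar>"
        by (intro tendsto_intros lim D')
      then have "\<bar>G h - G 0 - h * D'\<bar> \<le> e / 2 * \<bar>h\<bar>"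
        by (rule LIMSEQ_le_const2) (use \<delta>(2)[of h] h in auto)
      moreover have "G h - G 0 - h * D' = h * ((G h - G 0) / h - D')"
        using h by (simp add: field_simps)
      then have "\<bar>G h - G 0 - h * D'\<bar> = \<bar>h\<bar> * \<bar>(G h - G 0) / h - D'\<bar>"
        by (simp only: abs_mult)
      ultimately have "\<bar>h\<bar> * \<bar>(G h - G 0) / h - D'\<bar> \<le> \<bar>h\<bar> * (e / 2)" by (simp add: mult.commute)
      then have "\<bar>(G h - G 0) / h - D'\<bar> \<le> e / 2" using h by simp
      then show ?thesis using e by simp
    qed
    then show "\<exists>s>0. \<forall>x. x \<noteq> 0 \<and> norm (x - 0) < s \<longrightarrow> norm ((G (0 + x) - G 0) / x - D') < e"
      using \<delta>(1) by blast
  qed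
  then have "deriv G 0 = D'" by (rule DERIV_imp_deriv)
  with D' show ?thesis by simp
qed

section \<open>Energies as integrals of increments\<close>

definition increment :: "('a \<Rightarrow> real) \<Rightarrow> 'a \<times> 'a \<Rightarrow> real" where
  "increment f z = f (fst z) - f (snd z)"

locale kernel_energy =
  fixes p :: real and m :: "'a::{metric_space, second_countable_topology} measure"
    and k :: "real \<Rightarrow> 'a \<times> 'a \<Rightarrow> ennreal" and r :: "nat \<Rightarrow> real"
  assumes p: "1 < p"
    and sets_m: "sets m = sets borel"
    and sigma_finite: "sigma_finite_measure m"
    and kernel_measurable: "0 < s \<Longrightarrow> k s \<in> borel_measurable borel"
    and r_pos: "0 < r n"
    and energy_limit: "f \<in> B_space p m k \<Longrightarrow> \<exists>L. L < \<infinity> \<and> (\<lambda>n. J_fun p m k (r n) f) \<longlonglongrightarrow> L"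
begin

abbreviation B :: "('a \<Rightarrow> real) set" where "B \<equiv> B_space p m k"

text \<open>
  With respect to this measure on pairs the energy is the integral of \<open>\<bar>f x - f y\<bar> powr p\<close>. The density
  may take the value \<open>\<infinity>\<close>, so the measure need not be \<open>\<sigma>\<close>-finite.
\<close>

definition jump_measure :: "real \<Rightarrow> ('a \<times> 'a) measure" where
  "jump_measure s = density (m \<Otimes>\<^sub>M m) (k s)"

lemma sets_pair_m: "sets (m \<Otimes>\<^sub>M m) = sets (borel \<Otimes>\<^sub>M borel)"
  by (intro sets_pair_measure_cong sets_m)

lemma measurable_pair_m: "measurable (m \<Otimes>\<^sub>M m) X = measurable (borel \<Otimes>\<^sub>M borel) X"
  by (rule measurable_cong_sets[OF sets_pair_m refl])

lemma measurable_jump_measure: "measurable (jump_measure s) X = measurable (borel \<Otimes>\<^sub>M borel) X"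
  by (intro measurable_cong_sets) (simp_all add: jump_measure_def sets_pair_m)

lemma measurable_m: "measurable m X = measurable borel X"
  by (rule measurable_cong_sets[OF sets_m refl])

lemma kernel_measurable_pair: "0 < s \<Longrightarrow> k s \<in> borel_measurable (m \<Otimes>\<^sub>M m)"
  using kernel_measurable[of s] by (simp add: measurable_pair_m borel_prod)

lemma measurable_fst_jump_measure [measurable]:
  "f \<in> borel_measurable borel \<Longrightarrow> (\<lambda>z. f (fst z)) \<in> borel_measurable (jump_measure s)"
  unfolding measurable_jump_measure by (rule measurable_compose[OF measurable_fst])

lemma measurable_snd_jump_measure [measurable]:
  "f \<in> borel_measurable borel \<Longrightarrow> (\<lambda>z. f (snd z)) \<in> borel_measurable (jump_measure s)"
  unfolding measurable_jump_measure
  by (rule measurable_compose[of snd "borel \<Otimes>\<^sub>M borel" borel f, OF measurable_snd])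

lemma measurable_increment_jump_measure [measurable]:
  "f \<in> borel_measurable borel \<Longrightarrow> increment f \<in> borel_measurable (jump_measure s)"
  unfolding increment_def[abs_def]
    by (intro borel_measurable_diff measurable_fst_jump_measure measurable_snd_jump_measure)

lemma nn_integral_jump_measure:
  assumes "0 < s" "g \<in> borel_measurable (jump_measure s)"
  shows "(\<integral>\<^sup>+z. g z \<partial>jump_measure s) = (\<integral>\<^sup>+x. \<integral>\<^sup>+y. g (x, y) * k s (x, y) \<partial>m \<partial>m)"
proof -
  have g: "g \<in> borel_measurable (m \<Otimes>\<^sub>M m)" using assms(2)
    by (simp add: measurable_jump_measure measurable_pair_m)
  have "(\<integral>\<^sup>+z. g z \<partial>jump_measure s) = (\<integral>\<^sup>+z. k s z * g z \<partial>(m \<Otimes>\<^sub>M m))"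
    unfolding jump_measure_def by (intro nn_integral_density kernel_measurable_pair assms g)
  also have "\<dots> = (\<integral>\<^sup>+x. \<integral>\<^sup>+y. k s (x, y) * g (x, y) \<partial>m \<partial>m)"
    using kernel_measurable_pair[OF assms(1)] g
    by (intro sigma_finite_measure.nn_integral_fst[OF sigma_finite, symmetric]) simp
  finally show ?thesis by (simp add: mult.commute)
qed

lemma B_measurable: "f \<in> B \<Longrightarrow> f \<in> borel_measurable borel"
  by (simp add: B_space_def Lp_fun_def measurable_m)

lemma J_eq:
  assumes "f \<in> borel_measurable borel" "0 < s"
  shows "J_fun p m k s f = (\<integral>\<^sup>+z. ennreal (\<bar>increment f z\<bar> powr p) \<partial>jump_measure s)"
  unfolding J_fun_def using assms by (subst nn_integral_jump_measure) (auto simp: increment_def)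

lemma B_bound:
  assumes "f \<in> B" obtains S where "0 \<le> S" "\<And>s. 0 < s \<Longrightarrow> J_fun p m k s f \<le> ennreal S"
proof -
  have fin: "(SUP s\<in>{0<..}. J_fun p m k s f) < \<infinity>" using assms by (simp add: B_space_def)
  show thesis
  proof (rule that[of "enn2real (SUP s\<in>{0<..}. J_fun p m k s f)"])
    fix s :: real assume "0 < s"
    then have "J_fun p m k s f \<le> (SUP s\<in>{0<..}. J_fun p m k s f)" by (intro SUP_upper) simp
    then show "J_fun p m k s f \<le> ennreal (enn2real (SUP s\<in>{0<..}. J_fun p m k s f))"
      using fin by simp
  qed simp
qed

lemma integrable_increment:
  assumes f: "f \<in> B" and s: "0 < s"
  shows "integrable (jump_measure s) (\<lambda>z. \<bar>increment f z\<bar> powr p)"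
proof (rule integrableI_nonneg)
  show "(\<lambda>z. \<bar>increment f z\<bar> powr p) \<in> borel_measurable (jump_measure s)"
    using B_measurable[OF f] by measurable
  obtain S where "J_fun p m k s f \<le> ennreal S" using B_bound[OF f] s by metis
  then show "(\<integral>\<^sup>+z. ennreal (\<bar>increment f z\<bar> powr p) \<partial>jump_measure s) < \<infinity>"
    using J_eq[OF B_measurable[OF f] s] by (auto intro: order_le_less_trans)
qed simp

definition energy :: "nat \<Rightarrow> ('a \<Rightarrow> real) \<Rightarrow> real" where
  "energy n f = (\<integral>z. \<bar>increment f z\<bar> powr p \<partial>jump_measure (r n))"

lemma energy_nonneg: "0 \<le> energy n f"
  by (simp add: energy_def)

lemma J_eq_energy: "f \<in> B \<Longrightarrow> J_fun p m k (r n) f = ennreal (energy n f)"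
  unfolding J_eq[OF B_measurable r_pos] energy_def
  by (intro nn_integral_eq_integral integrable_increment r_pos) auto

lemma energy_bounded:
  assumes "f \<in> B" obtains S where "0 \<le> S" "\<And>n. energy n f \<le> S"
proof -
  obtain S where S: "0 \<le> S" "\<And>s. 0 < s \<Longrightarrow> J_fun p m k s f \<le> ennreal S" using B_bound[OF assms] by blast
  have "energy n f \<le> S" for n
    using S(2)[OF r_pos[of n]] S(1) energy_nonneg unfolding J_eq_energy[OF assms] by simp
  with S(1) that show thesis by blast
qed

lemma energy_tendsto_p_energy:
  assumes "f \<in> B"
  shows "p_energy p m k r f < \<infinity>" and "(\<lambda>n. energy n f) \<longlonglongrightarrow> enn2real (p_energy p m k r f)"
proof -
  obtain L where L: "L < \<infinity>" "(\<lambda>n. J_fun p m k (r n) f) \<longlonglongrightarrow> L" using energy_limit[OF assms] by blast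
  have eq: "p_energy p m k r f = L" unfolding p_energy_def by (rule limI[OF L(2)])
  show "p_energy p m k r f < \<infinity>" using L(1) eq by simp
  have "(\<lambda>n. enn2real (ennreal (energy n f))) \<longlonglongrightarrow> enn2real L"
    using L unfolding J_eq_energy[OF assms] by (intro tendsto_enn2real) (auto simp: less_top)
  then show "(\<lambda>n. energy n f) \<longlonglongrightarrow> enn2real (p_energy p m k r f)" by (simp add: energy_nonneg eq)
qed

text \<open>
  A contraction principle for pairs: functions whose size and increments are dominated by those of
  two functions of finite energy. Linear combinations, products, powers and truncations are
  instances.
\<close>

lemma B_dominated:
  assumes f: "f \<in> B" and h: "h \<in> B" and g: "g \<in> borel_measurable borel" and C: "0 \<le> C"
    and size: "\<And>x. \<bar>g x\<bar> \<le> C * (\<bar>f x\<bar> + \<bar>h x\<bar>)"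
    and inc: "\<And>x y. \<bar>g x - g y\<bar> \<le> C * (\<bar>f x - f y\<bar> + \<bar>h x - h y\<bar>)"
  shows "g \<in> B"
proof -
  define D where "D = (2 * C) powr p"
  have D: "0 \<le> D" by (simp add: D_def)
  have powr_le: "c powr p \<le> D * (\<bar>a\<bar> powr p + \<bar>b\<bar> powr p)" if "0 \<le> c" "c \<le> C * (\<bar>a\<bar> + \<bar>b\<bar>)" for a b c
  proof -
    have "c powr p \<le> (C * (\<bar>a\<bar> + \<bar>b\<bar>)) powr p" using that p by (intro powr_mono2) auto
    also have "\<dots> = C powr p * \<bar>\<bar>a\<bar> + \<bar>b\<bar>\<bar> powr p" using C by (simp add: powr_mult)
    also have "\<dots> \<le> C powr p * (2 powr p * (\<bar>\<bar>a\<bar>\<bar> powr p + \<bar>\<bar>b\<bar>\<bar> powr p))"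
      using p by (intro mult_left_mono powr_add_le) auto
    finally show ?thesis using C by (simp add: D_def powr_mult ac_simps)
  qed
  note [measurable] = B_measurable[OF f] B_measurable[OF h] g
  have "integrable m (\<lambda>x. \<bar>g x\<bar> powr p)"
  proof (rule Bochner_Integration.integrable_bound)
    show "integrable m (\<lambda>x. D * (\<bar>f x\<bar> powr p + \<bar>h x\<bar> powr p))"
      using f h by (auto simp: B_space_def Lp_fun_def)
    show "(\<lambda>x. \<bar>g x\<bar> powr p) \<in> borel_measurable m"
      unfolding measurable_m by measurable
    show "AE x in m. norm (\<bar>g x\<bar> powr p) \<le> norm (D * (\<bar>f x\<bar> powr p + \<bar>h x\<bar> powr p))"
      using powr_le size D by auto
  qed
  moreover have "(SUP s\<in>{0<..}. J_fun p m k s g) < \<infinity>"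
  proof -
    obtain S S' where S: "0 \<le> S" "\<And>s. 0 < s \<Longrightarrow> J_fun p m k s f \<le> ennreal S"
      and S': "0 \<le> S'" "\<And>s. 0 < s \<Longrightarrow> J_fun p m k s h \<le> ennreal S'"
      using B_bound[OF f] B_bound[OF h] by metis
    have "J_fun p m k s g \<le> ennreal (D * (S + S'))" if s: "0 < s" for s
    proof -
      have "J_fun p m k s g = (\<integral>\<^sup>+z. ennreal (\<bar>increment g z\<bar> powr p) \<partial>jump_measure s)"
        by (rule J_eq[OF g s])
      also have "\<dots> \<le> (\<integral>\<^sup>+z. ennreal D * (ennreal (\<bar>increment f z\<bar> powr p) + ennreal (\<bar>increment h z\<bar> powr p)) \<partial>jump_measure s)"
      proof (rule nn_integral_mono)
        fix z
        have "\<bar>increment g z\<bar> powr p \<le> D * (\<bar>increment f z\<bar> powr p + \<bar>increment h z\<bar> powr p)"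
          using powr_le inc by (simp add: increment_def)
        then show "ennreal (\<bar>increment g z\<bar> powr p) \<le>
            ennreal D * (ennreal (\<bar>increment f z\<bar> powr p) + ennreal (\<bar>increment h z\<bar> powr p))"
          using D by (simp add: ennreal_leI flip: ennreal_plus ennreal_mult)
      qed
      also have "\<dots> = ennreal D * (J_fun p m k s f + J_fun p m k s h)"
        by (subst nn_integral_cmult, measurable, subst nn_integral_add, measurable)
           (simp add: J_eq[OF _ s])
      also have "\<dots> \<le> ennreal D * (ennreal S + ennreal S')"
        by (intro mult_left_mono add_mono S S' s) auto
      also have "\<dots> = ennreal (D * (S + S'))"
        using D S S' by (simp add: ennreal_mult)
      finally show ?thesis .
    qed
    then have "(SUP s\<in>{0<..}. J_fun p m k s g) \<le> ennreal (D * (S + S'))" by (intro SUP_least) auto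
    then show ?thesis by (rule order_le_less_trans) simp
  qed
  ultimately show ?thesis using g by (simp add: B_space_def Lp_fun_def measurable_m)
qed

lemma B_add_scaled:
  assumes "f \<in> B" "g \<in> B" shows "(\<lambda>x. f x + t * g x) \<in> B"
proof (rule B_dominated[OF assms, of _ "1 + \<bar>t\<bar>"])
  show "(\<lambda>x. f x + t * g x) \<in> borel_measurable borel"
    using B_measurable[OF assms(1)] B_measurable[OF assms(2)] by measurable
  have *: "\<bar>a + t * b\<bar> \<le> (1 + \<bar>t\<bar>) * (\<bar>a\<bar> + \<bar>b\<bar>)" for a b
  proof -
    have "\<bar>a + t * b\<bar> \<le> \<bar>a\<bar> + \<bar>t\<bar> * \<bar>b\<bar>" using abs_triangle_ineq[of a "t * b"] by (simp add: abs_mult)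
    also have "\<dots> \<le> (1 + \<bar>t\<bar>) * (\<bar>a\<bar> + \<bar>b\<bar>)" by (simp add: algebra_simps)
    finally show ?thesis .
  qed
  show "\<bar>f x + t * g x\<bar> \<le> (1 + \<bar>t\<bar>) * (\<bar>f x\<bar> + \<bar>g x\<bar>)" for x by (rule *)
  show "\<bar>f x + t * g x - (f y + t * g y)\<bar> \<le> (1 + \<bar>t\<bar>) * (\<bar>f x - f y\<bar> + \<bar>g x - g y\<bar>)" for x y
    using *[of "f x - f y" "g x - g y"] by (simp add: algebra_simps)
qed simp

lemma B_mult:
  assumes f: "f \<in> B" and g: "g \<in> B" and C: "\<And>x. \<bar>f x\<bar> \<le> C" "\<And>x. \<bar>g x\<bar> \<le> C"
  shows "(\<lambda>x. f x * g x) \<in> B"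
proof (rule B_dominated[OF f g, of _ C])
  show "(\<lambda>x. f x * g x) \<in> borel_measurable borel"
    using B_measurable[OF f] B_measurable[OF g] by measurable
  show "0 \<le> C" using C(1)[of undefined] by linarith
  show "\<bar>f x * g x\<bar> \<le> C * (\<bar>f x\<bar> + \<bar>g x\<bar>)" for x
  proof -
    have "\<bar>f x * g x\<bar> \<le> C * \<bar>g x\<bar>" unfolding abs_mult by (intro mult_right_mono C) auto
    moreover have "0 \<le> C * \<bar>f x\<bar>" using \<open>0 \<le> C\<close> by simp
    ultimately show ?thesis by (simp add: distrib_left)
  qed
  show "\<bar>f x * g x - f y * g y\<bar> \<le> C * (\<bar>f x - f y\<bar> + \<bar>g x - g y\<bar>)" for x y
  proof -
    have "f x * g x - f y * g y = (f x - f y) * g x + f y * (g x - g y)" by (simp add: algebra_simps)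
    also have "\<bar>\<dots>\<bar> \<le> \<bar>f x - f y\<bar> * \<bar>g x\<bar> + \<bar>f y\<bar> * \<bar>g x - g y\<bar>"
      unfolding abs_mult[symmetric] by (rule abs_triangle_ineq)
    also have "\<dots> \<le> \<bar>f x - f y\<bar> * C + C * \<bar>g x - g y\<bar>"
      by (intro add_mono mult_left_mono mult_right_mono C) auto
    finally show ?thesis by (simp add: algebra_simps)
  qed
qed

lemma B_abs_powr:
  assumes f: "f \<in> B" and C: "\<And>x. \<bar>f x\<bar> \<le> C" and q: "1 < q"
  shows "(\<lambda>x. \<bar>f x\<bar> powr q) \<in> B"
proof (rule B_dominated[OF f f, of _ "q * C powr (q - 1)"])
  show "(\<lambda>x. \<bar>f x\<bar> powr q) \<in> borel_measurable borel"
    using B_measurable[OF f] by measurable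
  have "0 \<le> C" using C[of undefined] by linarith
  show nn: "0 \<le> q * C powr (q - 1)" using q by simp
  \<comment> \<open>The contraction principle takes two functions; here both are \<open>f\<close>.\<close>
  have dbl: "c \<le> q * C powr (q - 1) * (\<bar>d\<bar> + \<bar>d\<bar>)" if "c \<le> q * C powr (q - 1) * \<bar>d\<bar>" for c d
  proof -
    have "0 \<le> q * C powr (q - 1) * \<bar>d\<bar>" using nn by simp
    then show ?thesis using that by (simp add: distrib_left)
  qed
  show "\<bar>\<bar>f x\<bar> powr q\<bar> \<le> q * C powr (q - 1) * (\<bar>f x\<bar> + \<bar>f x\<bar>)" for x
    using dbl[OF order_trans[OF eq_refl abs_powr_lipschitz[OF q C[of x], of 0]]] \<open>0 \<le> C\<close> q by simp
  show "\<bar>\<bar>f x\<bar> powr q - \<bar>f y\<bar> powr q\<bar> \<le> q * C powr (q - 1) * (\<bar>f x - f y\<bar> + \<bar>f x - f y\<bar>)" for x y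
    using dbl[OF abs_powr_lipschitz[OF q C[of x] C[of y]]] .
qed

definition energy_form :: "nat \<Rightarrow> ('a \<Rightarrow> real) \<Rightarrow> ('a \<Rightarrow> real) \<Rightarrow> real" where
  "energy_form n f g = (\<integral>z. signed_powr (p - 1) (increment f z) * increment g z \<partial>jump_measure (r n))"

lemma integrable_energy_form:
  assumes f: "f \<in> B" and g: "g \<in> B" and s: "0 < s"
  shows "integrable (jump_measure s) (\<lambda>z. signed_powr (p - 1) (increment f z) * increment g z)"
proof (rule Bochner_Integration.integrable_bound)
  note [measurable] = B_measurable[OF f] B_measurable[OF g]
  show "integrable (jump_measure s) (\<lambda>z. \<bar>increment f z\<bar> powr p + \<bar>increment g z\<bar> powr p)"
    by (intro Bochner_Integration.integrable_add integrable_increment f g s)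
  show "(\<lambda>z. signed_powr (p - 1) (increment f z) * increment g z) \<in> borel_measurable (jump_measure s)"
    unfolding signed_powr_def by measurable
  show "AE z in jump_measure s. norm (signed_powr (p - 1) (increment f z) * increment g z)
      \<le> norm (\<bar>increment f z\<bar> powr p + \<bar>increment g z\<bar> powr p)"
    using signed_powr_mult_le[OF p] by (intro AE_I2) simp
qed

text \<open>
  Integrating the uniform differentiability of \<open>\<bar>s\<bar> powr p\<close> against the jump measures gives an error that
  is uniform in \<open>n\<close>, because the energies of \<open>f\<close> and \<open>g\<close> are bounded over all scales.
\<close>

lemma energy_form_tendsto_p_energy_form:
  assumes f: "f \<in> B" and g: "g \<in> B"
  shows "(\<lambda>n. energy_form n f g) \<longlonglongrightarrow> p_energy_form p m k r f g"
proof -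
  obtain Sf Sg where S: "0 \<le> Sf" "\<And>n. energy n f \<le> Sf" "0 \<le> Sg" "\<And>n. energy n g \<le> Sg"
    using energy_bounded[OF f] energy_bounded[OF g] by metis
  have "(\<lambda>n. p * energy_form n f g) \<longlonglongrightarrow> deriv (\<lambda>t. enn2real (p_energy p m k r (\<lambda>x. f x + t * g x))) 0"
  proof (rule limit_of_derivatives)
    show "(\<lambda>n. energy n (\<lambda>x. f x + t * g x)) \<longlonglongrightarrow> enn2real (p_energy p m k r (\<lambda>x. f x + t * g x))" for t
      by (intro energy_tendsto_p_energy B_add_scaled f g)
    fix \<epsilon> :: real assume \<epsilon>: "0 < \<epsilon>"
    define \<epsilon>' where "\<epsilon>' = \<epsilon> / (Sf + Sg + 1)"
    have \<epsilon>': "0 < \<epsilon>'" "\<epsilon>' * (Sf + Sg) \<le> \<epsilon>" using \<epsilon> S by (auto simp: \<epsilon>'_def field_simps)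
    obtain \<delta> where \<delta>: "0 < \<delta>" "\<And>a b t :: real. \<bar>t\<bar> \<le> \<delta> \<Longrightarrow>
       \<bar>\<bar>a + t * b\<bar> powr p - \<bar>a\<bar> powr p - t * (p * (signed_powr (p - 1) a * b))\<bar>
         \<le> \<epsilon>' * \<bar>t\<bar> * (\<bar>a\<bar> powr p + \<bar>b\<bar> powr p)"
      by (rule abs_powr_uniformly_differentiable[OF p \<epsilon>'(1)]) blast
    have "\<bar>energy n (\<lambda>x. f x + t * g x) - energy n (\<lambda>x. f x + 0 * g x) - t * (p * energy_form n f g)\<bar> \<le> \<epsilon> * \<bar>t\<bar>"
      if t: "\<bar>t\<bar> \<le> \<delta>" for n t
    proof -
      have inc: "increment (\<lambda>x. f x + t * g x) z = increment f z + t * increment g z" for z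
        by (simp add: increment_def algebra_simps)
      have int: "integrable (jump_measure (r n)) (\<lambda>z. \<bar>increment f z + t * increment g z\<bar> powr p)"
        using integrable_increment[OF B_add_scaled[OF f g, of t] r_pos] by (simp add: inc)
      note ints = int integrable_increment[OF f r_pos] integrable_increment[OF g r_pos]
        integrable_energy_form[OF f g r_pos]
      have eq: "energy n (\<lambda>x. f x + t * g x) - energy n (\<lambda>x. f x + 0 * g x) - t * (p * energy_form n f g)
        = (\<integral>z. \<bar>increment f z + t * increment g z\<bar> powr p - \<bar>increment f z\<bar> powr p
             - t * (p * (signed_powr (p - 1) (increment f z) * increment g z)) \<partial>jump_measure (r n))"
        using ints by (simp add: energy_def energy_form_def inc)
      have "\<bar>energy n (\<lambda>x. f x + t * g x) - energy n (\<lambda>x. f x + 0 * g x) - t * (p * energy_form n f g)\<bar>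
          \<le> (\<integral>z. \<bar>\<bar>increment f z + t * increment g z\<bar> powr p - \<bar>increment f z\<bar> powr p
             - t * (p * (signed_powr (p - 1) (increment f z) * increment g z))\<bar> \<partial>jump_measure (r n))"
        unfolding eq by (rule integral_abs_bound)
      also have "\<dots> \<le> (\<integral>z. \<epsilon>' * \<bar>t\<bar> * (\<bar>increment f z\<bar> powr p + \<bar>increment g z\<bar> powr p) \<partial>jump_measure (r n))"
      proof (rule integral_mono)
        show "\<bar>\<bar>increment f z + t * increment g z\<bar> powr p - \<bar>increment f z\<bar> powr p
             - t * (p * (signed_powr (p - 1) (increment f z) * increment g z))\<bar>
           \<le> \<epsilon>' * \<bar>t\<bar> * (\<bar>increment f z\<bar> powr p + \<bar>increment g z\<bar> powr p)" for z
          by (rule \<delta>(2)[OF t])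
      qed (use ints in simp_all)
      also have "\<dots> = \<epsilon>' * \<bar>t\<bar> * (energy n f + energy n g)"
        using ints by (simp add: energy_def)
      also have "\<dots> \<le> \<epsilon>' * \<bar>t\<bar> * (Sf + Sg)"
        using \<epsilon>'(1) by (intro mult_left_mono add_mono S) auto
      also have "\<dots> = (\<epsilon>' * (Sf + Sg)) * \<bar>t\<bar>" by simp
      also have "\<dots> \<le> \<epsilon> * \<bar>t\<bar>" by (intro mult_right_mono \<epsilon>') auto
      finally show ?thesis .
    qed
    then show "\<exists>\<delta>>0. \<forall>n t. \<bar>t\<bar> \<le> \<delta> \<longrightarrow>
       \<bar>energy n (\<lambda>x. f x + t * g x) - energy n (\<lambda>x. f x + 0 * g x) - t * (p * energy_form n f g)\<bar> \<le> \<epsilon> * \<bar>t\<bar>"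
      using \<delta>(1) by blast
  qed
  then have "(\<lambda>n. 1 / p * (p * energy_form n f g)) \<longlonglongrightarrow> p_energy_form p m k r f g"
    unfolding p_energy_form_def by (rule tendsto_mult_left)
  then show ?thesis using p by simp
qed

section \<open>Weighted energies\<close>

definition weighted_energy :: "('a \<Rightarrow> real) \<Rightarrow> nat \<Rightarrow> ('a \<Rightarrow> real) \<Rightarrow> real" where
  "weighted_energy u n f = (\<integral>z. f (fst z) * \<bar>increment u z\<bar> powr p \<partial>jump_measure (r n))"

lemma integrable_weighted_energy:
  assumes u: "u \<in> B" and f: "f \<in> borel_measurable borel" "\<And>x. \<bar>f x\<bar> \<le> C" and s: "0 < s"
  shows "integrable (jump_measure s) (\<lambda>z. f (fst z) * \<bar>increment u z\<bar> powr p)"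
proof (rule Bochner_Integration.integrable_bound)
  note [measurable] = B_measurable[OF u] f(1)
  show "integrable (jump_measure s) (\<lambda>z. C * \<bar>increment u z\<bar> powr p)"
    using integrable_increment[OF u s] by simp
  show "(\<lambda>z. f (fst z) * \<bar>increment u z\<bar> powr p) \<in> borel_measurable (jump_measure s)" by measurable
  show "AE z in jump_measure s. norm (f (fst z) * \<bar>increment u z\<bar> powr p) \<le> norm (C * \<bar>increment u z\<bar> powr p)"
  proof (rule AE_I2)
    fix z :: "'a \<times> 'a"
    have "\<bar>f (fst z)\<bar> \<le> \<bar>C\<bar>" using f(2)[of "fst z"] by linarith
    then show "norm (f (fst z) * \<bar>increment u z\<bar> powr p) \<le> norm (C * \<bar>increment u z\<bar> powr p)"
      by (simp add: abs_mult mult_right_mono)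
  qed
qed

lemma weighted_energy_bound:
  assumes u: "u \<in> B" and f: "f \<in> borel_measurable borel" "\<And>x. \<bar>f x\<bar> \<le> C"
  shows "\<bar>weighted_energy u n f\<bar> \<le> C * energy n u"
proof -
  have "\<bar>weighted_energy u n f\<bar> \<le> (\<integral>z. \<bar>f (fst z) * \<bar>increment u z\<bar> powr p\<bar> \<partial>jump_measure (r n))"
    unfolding weighted_energy_def by (rule integral_abs_bound)
  also have "\<dots> \<le> (\<integral>z. C * \<bar>increment u z\<bar> powr p \<partial>jump_measure (r n))"
  proof (rule integral_mono)
    show "integrable (jump_measure (r n)) (\<lambda>z. \<bar>f (fst z) * \<bar>increment u z\<bar> powr p\<bar>)"
      by (rule integrable_abs[OF integrable_weighted_energy[OF u f r_pos]])
    show "integrable (jump_measure (r n)) (\<lambda>z. C * \<bar>increment u z\<bar> powr p)"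
      using integrable_increment[OF u r_pos] by simp
    show "\<bar>f (fst z) * \<bar>increment u z\<bar> powr p\<bar> \<le> C * \<bar>increment u z\<bar> powr p" for z
      using f(2)[of "fst z"] by (simp add: abs_mult mult_right_mono)
  qed
  also have "\<dots> = C * energy n u" by (simp add: energy_def)
  finally show ?thesis .
qed

text \<open>
  The energy of \<open>u\<close> is finite, so the product of the power of the increment and the kernel is finite
  almost everywhere, and taking its real part loses nothing.
\<close>

lemma weighted_J_eq_weighted_energy:
  assumes u: "u \<in> B" and f: "f \<in> borel_measurable borel" "\<And>x. \<bar>f x\<bar> \<le> C"
  shows "weighted_J p m k (r n) u f = weighted_energy u n f"
proof -
  define w where "w z = ennreal (\<bar>increment u z\<bar> powr p) * k (r n) z" for z
  note [measurable] = B_measurable[OF u] f(1)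
  have [measurable]: "k (r n) \<in> borel_measurable (m \<Otimes>\<^sub>M m)" by (rule kernel_measurable_pair[OF r_pos])
  have m1 [measurable]: "increment u \<in> borel_measurable (m \<Otimes>\<^sub>M m)"
    using measurable_increment_jump_measure[OF B_measurable[OF u]]
      unfolding measurable_jump_measure measurable_pair_m .
  have m2 [measurable]: "(\<lambda>z. f (fst z)) \<in> borel_measurable (m \<Otimes>\<^sub>M m)"
    using measurable_fst_jump_measure[OF f(1)] unfolding measurable_jump_measure measurable_pair_m .
  have w [measurable]: "w \<in> borel_measurable (m \<Otimes>\<^sub>M m)" unfolding w_def by measurable
  \<comment> \<open>Nonnegative integrals first: the density of the jump measure may be infinite.\<close>
  have nn_eq: "(\<integral>\<^sup>+z. ennreal (g z * \<bar>increment u z\<bar> powr p) \<partial>jump_measure (r n))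
      = (\<integral>\<^sup>+z. ennreal (g z * enn2real (w z)) \<partial>(m \<Otimes>\<^sub>M m))"
    if g: "g \<in> borel_measurable (m \<Otimes>\<^sub>M m)" for g
  proof -
    have "(\<integral>\<^sup>+z. w z \<partial>(m \<Otimes>\<^sub>M m)) = (\<integral>\<^sup>+z. ennreal (\<bar>increment u z\<bar> powr p) \<partial>jump_measure (r n))"
      unfolding jump_measure_def w_def by (subst nn_integral_density) (auto simp: mult.commute)
    also have "\<dots> < \<infinity>"
      using J_eq[OF B_measurable[OF u] r_pos] J_eq_energy[OF u]
        by (metis ennreal_less_top infinity_ennreal_def)
    finally have "AE z in m \<Otimes>\<^sub>M m. w z \<noteq> \<infinity>"
      by (intro nn_integral_PInf_AE w) auto
    moreover have "(\<integral>\<^sup>+z. ennreal (g z * \<bar>increment u z\<bar> powr p) \<partial>jump_measure (r n))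
       = (\<integral>\<^sup>+z. k (r n) z * ennreal (g z * \<bar>increment u z\<bar> powr p) \<partial>(m \<Otimes>\<^sub>M m))"
      unfolding jump_measure_def using g by (subst nn_integral_density) auto
    moreover have "k (r n) z * ennreal (g z * \<bar>increment u z\<bar> powr p) = ennreal (g z * enn2real (w z))"
      if "w z \<noteq> \<infinity>" for z
    proof (cases "0 \<le> g z")
      case True
      have "k (r n) z * ennreal (g z * \<bar>increment u z\<bar> powr p) = ennreal (g z) * w z"
        using True by (simp add: w_def ennreal_mult ac_simps)
      also have "\<dots> = ennreal (g z * enn2real (w z))"
        using True that by (simp add: ennreal_mult less_top)
      finally show ?thesis .
    next
      case False
      then have "g z * \<bar>increment u z\<bar> powr p \<le> 0" "g z * enn2real (w z) \<le> 0"
        by (auto intro: mult_nonpos_nonneg)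
      then show ?thesis by (simp add: ennreal_neg)
    qed
    ultimately show ?thesis by (auto intro!: nn_integral_cong_AE)
  qed
  have int: "integrable (m \<Otimes>\<^sub>M m) (\<lambda>z. f (fst z) * enn2real (w z))"
  proof (rule integrableI_bounded)
    have "(\<integral>\<^sup>+z. ennreal (norm (f (fst z) * enn2real (w z))) \<partial>(m \<Otimes>\<^sub>M m))
       = (\<integral>\<^sup>+z. ennreal (norm (f (fst z) * \<bar>increment u z\<bar> powr p)) \<partial>jump_measure (r n))"
      using nn_eq[of "\<lambda>z. \<bar>f (fst z)\<bar>"] by (simp add: abs_mult)
    also have "\<dots> < \<infinity>" using integrable_weighted_energy[OF u f r_pos[of n]]
      by (simp add: integrable_iff_bounded)
    finally show "(\<integral>\<^sup>+z. ennreal (norm (f (fst z) * enn2real (w z))) \<partial>(m \<Otimes>\<^sub>M m)) < \<infinity>" .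
  qed measurable
  have "weighted_J p m k (r n) u f = (\<integral>x. (\<integral>y. f (fst (x, y)) * enn2real (w (x, y)) \<partial>m) \<partial>m)"
    by (simp add: weighted_J_def w_def increment_def)
  also have "\<dots> = (\<integral>z. f (fst z) * enn2real (w z) \<partial>(m \<Otimes>\<^sub>M m))"
    using pair_sigma_finite.integral_fst'[OF pair_sigma_finite.intro[OF sigma_finite sigma_finite] int] .
  also have "\<dots> = weighted_energy u n f"
    unfolding weighted_energy_def real_lebesgue_integral_def[OF int]
      real_lebesgue_integral_def[OF integrable_weighted_energy[OF u f r_pos]]
    using nn_eq[of "\<lambda>z. f (fst z)"] nn_eq[of "\<lambda>z. - f (fst z)"] by simp
  finally show ?thesis .
qed

text \<open>
  The integrand \<open>R\<close> of the difference is bounded by \<open>\<bar>increment u\<bar> powr p * \<bar>increment f\<bar>\<close>. Where the points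
  are closer than \<open>\<delta> (r n)\<close> the second factor is small by uniform continuity, and the first one has
  bounded integral. On the complement \<open>F n\<close> the integrand is bounded and the measure tends to \<open>0\<close>.
\<close>

lemma weighted_energy_tendsto_energy_forms:
  assumes u: "u \<in> B" "\<And>x. \<bar>u x\<bar> \<le> C" and f: "f \<in> B" "\<And>x. \<bar>f x\<bar> \<le> C"
    and unif: "uniformly_continuous_on UNIV f"
    and local: "asymptotically_local m k" and r0: "r \<longlonglongrightarrow> 0"
  shows "(\<lambda>n. weighted_energy u n f) \<longlonglongrightarrow> p_energy_form p m k r u (\<lambda>x. u x * f x)
     - ((p - 1) / p) powr (p - 1) * p_energy_form p m k r (\<lambda>x. \<bar>u x\<bar> powr (p / (p - 1))) f"
proof -
  define v where "v = (\<lambda>x. \<bar>u x\<bar> powr (p / (p - 1)))"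
  define c where "c = ((p - 1) / p) powr (p - 1)"
  define R where "R z = signed_powr (p - 1) (increment u z) * increment (\<lambda>x. u x * f x) z
     - c * (signed_powr (p - 1) (increment v z) * increment f z) - f (fst z) * \<bar>increment u z\<bar> powr p" for z
  have q: "1 < p / (p - 1)" using p by simp
  have C: "0 \<le> C" using u(2)[of undefined] by linarith
  have v: "v \<in> B" unfolding v_def by (rule B_abs_powr[OF u q])
  have uf: "(\<lambda>x. u x * f x) \<in> B" by (rule B_mult[OF u(1) f(1) u(2) f(2)])
  note [measurable] = B_measurable[OF u(1)] B_measurable[OF f(1)] B_measurable[OF v]
  have R_int: "integrable (jump_measure (r n)) R" for n
    unfolding R_def[abs_def] using integrable_energy_form[OF u(1) uf r_pos] integrable_energy_form[OF v f(1) r_pos]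
      integrable_weighted_energy[OF u(1) B_measurable[OF f(1)] f(2) r_pos] by auto
  have R_eq: "(\<integral>z. R z \<partial>jump_measure (r n)) = energy_form n u (\<lambda>x. u x * f x)
      - c * energy_form n v f - weighted_energy u n f" for n
    unfolding R_def[abs_def] energy_form_def weighted_energy_def
    using integrable_energy_form[OF u(1) uf r_pos] integrable_energy_form[OF v f(1) r_pos]
      integrable_weighted_energy[OF u(1) B_measurable[OF f(1)] f(2) r_pos] by simp
  have R_le: "\<bar>R z\<bar> \<le> \<bar>increment u z\<bar> powr p * \<bar>increment f z\<bar>" for z
    unfolding R_def increment_def v_def c_def by (rule signed_powr_chain_rule_error[OF p])
  obtain \<delta> where \<delta>: "(\<delta> \<longlongrightarrow> 0) (at_right 0)"
     "((\<lambda>r. \<integral>\<^sup>+ x. (\<integral>\<^sup>+ y\<in>UNIV - ball x (\<delta> r). k r (x, y) \<partial>m) \<partial>m) \<longlongrightarrow> 0) (at_right 0)"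
    using local unfolding asymptotically_local_def by blast
  have r_right: "filterlim r (at_right 0) sequentially"
  proof -
    have "r n \<noteq> 0" for n using r_pos[of n] by simp
    with r0 r_pos show ?thesis by (auto simp: filterlim_at intro!: always_eventually)
  qed
  define F where "F n = {z :: 'a \<times> 'a. \<delta> (r n) \<le> dist (fst z) (snd z)}" for n
  have F_sets: "F n \<in> sets (jump_measure (r n))" for n
  proof -
    have "closed (F n)" unfolding F_def by (intro closed_Collect_le continuous_intros)
    then show ?thesis unfolding jump_measure_def sets_density sets_pair_m borel_prod by (rule borel_closed)
  qed
  have F_meas: "emeasure (jump_measure (r n)) (F n) = (\<integral>\<^sup>+ x. (\<integral>\<^sup>+ y\<in>UNIV - ball x (\<delta> (r n)). k (r n) (x, y) \<partial>m) \<partial>m)" for n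
  proof -
    have "emeasure (jump_measure (r n)) (F n) = (\<integral>\<^sup>+z. indicator (F n) z \<partial>jump_measure (r n))" using F_sets by simp
    also have "\<dots> = (\<integral>\<^sup>+x. \<integral>\<^sup>+y. indicator (F n) (x, y) * k (r n) (x, y) \<partial>m \<partial>m)"
      using F_sets by (intro nn_integral_jump_measure r_pos borel_measurable_indicator)
    also have "\<dots> = (\<integral>\<^sup>+ x. (\<integral>\<^sup>+ y\<in>UNIV - ball x (\<delta> (r n)). k (r n) (x, y) \<partial>m) \<partial>m)"
      by (intro nn_integral_cong) (auto simp: F_def indicator_def)
    finally show ?thesis .
  qed
  have F_lim: "(\<lambda>n. emeasure (jump_measure (r n)) (F n)) \<longlonglongrightarrow> 0"
    unfolding F_meas by (rule filterlim_compose[OF \<delta>(2) r_right])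
  have \<delta>_lim: "(\<lambda>n. \<delta> (r n)) \<longlonglongrightarrow> 0" by (rule filterlim_compose[OF \<delta>(1) r_right])
  obtain S where S: "0 \<le> S" "\<And>n. energy n u \<le> S" using energy_bounded[OF u(1)] by blast
  define A where "A = (2 * C) powr p * (2 * C)"
  have A: "0 \<le> A" using C by (simp add: A_def)
  have "(\<lambda>n. \<integral>z. R z \<partial>jump_measure (r n)) \<longlonglongrightarrow> 0"
  proof (rule LIMSEQ_I)
    fix e :: real assume e: "0 < e"
    define \<epsilon> where "\<epsilon> = e / (2 * (S + 1))"
    have \<epsilon>: "0 < \<epsilon>" "\<epsilon> * S < e / 2" using e S(1) by (auto simp: \<epsilon>_def field_simps)
    obtain \<eta> where \<eta>: "0 < \<eta>" "\<And>x y. dist y x < \<eta> \<Longrightarrow> dist (f y) (f x) < \<epsilon>"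
      by (rule uniformly_continuous_onE[OF unif \<epsilon>(1)]) blast
    define e' where "e' = e / (2 * (A + 1))"
    have e': "0 < e'" "A * e' < e / 2" using e A by (auto simp: e'_def field_simps)
    have "\<forall>\<^sub>F n in sequentially. \<delta> (r n) < \<eta>" using order_tendstoD(2)[OF \<delta>_lim \<eta>(1)] .
    moreover have "\<forall>\<^sub>F n in sequentially. emeasure (jump_measure (r n)) (F n) < ennreal e'"
      using order_tendstoD(2)[OF F_lim, of "ennreal e'"] e'(1) by simp
    ultimately have "\<forall>\<^sub>F n in sequentially. norm ((\<integral>z. R z \<partial>jump_measure (r n)) - 0) < e"
    proof eventually_elim
      case (elim n)
      have fin: "emeasure (jump_measure (r n)) (F n) < \<infinity>" using elim(2) by (auto intro: order.strict_trans)
      have ind: "integrable (jump_measure (r n)) (indicator (F n) :: _ \<Rightarrow> real)"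
        using F_sets fin by (intro integrable_real_indicator)
      have "measure (jump_measure (r n)) (F n) < e'"
        using elim(2) e'(1) fin by (simp add: emeasure_eq_ennreal_measure ennreal_less_iff)
      have "\<bar>R z\<bar> \<le> \<epsilon> * \<bar>increment u z\<bar> powr p + A * indicator (F n) z" for z
      proof (cases "z \<in> F n")
        case True
        have "\<bar>R z\<bar> \<le> (2 * C) powr p * (2 * C)"
        proof (rule order_trans[OF R_le], intro mult_mono powr_mono2)
          show "\<bar>increment u z\<bar> \<le> 2 * C" "\<bar>increment f z\<bar> \<le> 2 * C"
            using u(2)[of "fst z"] u(2)[of "snd z"] f(2)[of "fst z"] f(2)[of "snd z"]
            unfolding increment_def by linarith+
        qed (use p in auto)
        moreover have "0 \<le> \<epsilon> * \<bar>increment u z\<bar> powr p" using \<epsilon> by simp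
        ultimately show ?thesis using True by (simp add: A_def)
      next
        case False
        then have "dist (fst z) (snd z) < \<eta>" using elim(1) by (auto simp: F_def)
        then have "\<bar>increment f z\<bar> \<le> \<epsilon>" using \<eta>(2) by (force simp: increment_def dist_real_def)
        then have "\<bar>increment u z\<bar> powr p * \<bar>increment f z\<bar> \<le> \<bar>increment u z\<bar> powr p * \<epsilon>"
          by (intro mult_left_mono) auto
        then show ?thesis using R_le[of z] False by (simp add: mult.commute)
      qed
      then have "\<bar>\<integral>z. R z \<partial>jump_measure (r n)\<bar> \<le>
          (\<integral>z. \<epsilon> * \<bar>increment u z\<bar> powr p + A * indicator (F n) z \<partial>jump_measure (r n))"
        using R_int ind integrable_increment[OF u(1) r_pos]
        by (intro order_trans[OF integral_abs_bound] integral_mono) auto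
      also have "\<dots> = \<epsilon> * energy n u + A * measure (jump_measure (r n)) (F n)"
        using ind integrable_increment[OF u(1) r_pos] F_sets fin by (simp add: energy_def)
      also have "\<dots> \<le> \<epsilon> * S + A * e'"
        using \<epsilon> A S(2) \<open>measure (jump_measure (r n)) (F n) < e'\<close> by (intro add_mono mult_left_mono) auto
      also have "\<dots> < e" using \<epsilon>(2) e'(2) by simp
      finally show ?case by simp
    qed
    then show "\<exists>no. \<forall>n\<ge>no. norm ((\<integral>z. R z \<partial>jump_measure (r n)) - 0) < e"
      by (simp add: eventually_sequentially)
  qed
  then have "(\<lambda>n. energy_form n u (\<lambda>x. u x * f x) - c * energy_form n v f - (\<integral>z. R z \<partial>jump_measure (r n))) \<longlonglongrightarrow>
      p_energy_form p m k r u (\<lambda>x. u x * f x) - c * p_energy_form p m k r v f - 0"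
    by (intro tendsto_intros energy_form_tendsto_p_energy_form u(1) uf v f(1))
  then show ?thesis by (simp add: R_eq v_def c_def)
qed

end

section \<open>Construction of the energy measure\<close>

text \<open>
  Density of the functions of finite energy is stated for plain functions, because the approximants
  are truncated later and only their pointwise distance to \<open>f\<close> is used.
\<close>

locale energy_measure = kernel_energy +
  fixes u :: "'a \<Rightarrow> real" and C :: real
  assumes locally_compact: "locally_compact_space (euclidean :: 'a topology)"
    and local: "asymptotically_local m k"
    and r0: "r \<longlonglongrightarrow> 0"
    and dense: "f \<in> Cc_funs \<Longrightarrow> 0 < e \<Longrightarrow> \<exists>\<psi>\<in>Cc_funs \<inter> B. \<forall>x. \<bar>\<psi> x - f x\<bar> \<le> e"
    and u: "u \<in> B" and u_bounded: "\<bar>u x\<bar> \<le> C"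
begin

definition mass :: real where "mass = enn2real (p_energy p m k r u)"

lemma mass_nonneg: "0 \<le> mass" by (simp add: mass_def)

lemma energy_tendsto_mass: "(\<lambda>n. energy n u) \<longlonglongrightarrow> mass"
  unfolding mass_def by (rule energy_tendsto_p_energy(2)[OF u])

lemma Cc_funs_measurable: "f \<in> Cc_funs \<Longrightarrow> f \<in> borel_measurable borel"
  for f :: "'a \<Rightarrow> real"
  by (intro borel_measurable_continuous_onI Cc_funs_continuous)

lemma weighted_energy_add:
  assumes "f \<in> borel_measurable borel" "\<And>x. \<bar>f x\<bar> \<le> C1" "g \<in> borel_measurable borel" "\<And>x. \<bar>g x\<bar> \<le> C2"
  shows "weighted_energy u n (\<lambda>x. f x + t * g x) = weighted_energy u n f + t * weighted_energy u n g"
  using integrable_weighted_energy[OF u assms(1,2) r_pos] integrable_weighted_energy[OF u assms(3,4) r_pos]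
  by (simp add: weighted_energy_def distrib_right mult.assoc)

lemma weighted_energy_near:
  assumes f: "f \<in> borel_measurable borel" "\<And>x. \<bar>f x\<bar> \<le> C1" and g: "g \<in> borel_measurable borel" "\<And>x. \<bar>g x\<bar> \<le> C2"
    and fg: "\<And>x. \<bar>f x - g x\<bar> \<le> e"
  shows "\<bar>weighted_energy u n f - weighted_energy u n g\<bar> \<le> e * energy n u"
proof -
  have "weighted_energy u n f - weighted_energy u n g = weighted_energy u n (\<lambda>x. f x + (-1) * g x)"
    by (subst weighted_energy_add[OF f g]) simp
  then show ?thesis using weighted_energy_bound[OF u, of "\<lambda>x. f x + (-1) * g x" e n] f g fg by simp
qed

definition limit_functional :: "('a \<Rightarrow> real) \<Rightarrow> real" where
  "limit_functional f = lim (\<lambda>n. weighted_energy u n f)"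

lemma weighted_energy_tendsto_formula:
  assumes "f \<in> Cc_funs" "f \<in> B"
  shows "(\<lambda>n. weighted_energy u n f) \<longlonglongrightarrow> p_energy_form p m k r u (\<lambda>x. u x * f x)
     - ((p - 1) / p) powr (p - 1) * p_energy_form p m k r (\<lambda>x. \<bar>u x\<bar> powr (p / (p - 1))) f"
proof -
  obtain D where D: "\<And>x. \<bar>f x\<bar> \<le> D" using Cc_funs_bounded[OF assms(1)] by blast
  show ?thesis
  proof (rule weighted_energy_tendsto_energy_forms[OF u _ assms(2) _ _ local r0])
    show "\<bar>u x\<bar> \<le> max C D" "\<bar>f x\<bar> \<le> max C D" for x
      using u_bounded[of x] D[of x] by auto
    show "uniformly_continuous_on UNIV f" by (rule Cc_funs_uniformly_continuous[OF assms(1)])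
  qed
qed

lemma weighted_energy_convergent:
  assumes f: "f \<in> Cc_funs" shows "convergent (\<lambda>n. weighted_energy u n f)"
proof -
  obtain S where S: "0 \<le> S" "\<And>n. energy n u \<le> S" using energy_bounded[OF u] by blast
  have "Cauchy (\<lambda>n. weighted_energy u n f)"
  proof (rule metric_CauchyI)
    fix e :: real assume e: "0 < e"
    define d where "d = e / (4 * (S + 1))"
    have d: "0 < d" "d * S \<le> e / 4" using e S(1) by (auto simp: d_def field_simps)
    obtain \<psi> where \<psi>: "\<psi> \<in> Cc_funs" "\<psi> \<in> B" "\<And>x. \<bar>\<psi> x - f x\<bar> \<le> d"
      using dense[OF f d(1)] by blast
    obtain C1 C2 where C: "\<And>x. \<bar>\<psi> x\<bar> \<le> C1" "\<And>x. \<bar>f x\<bar> \<le> C2"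
      using Cc_funs_bounded[OF f] Cc_funs_bounded[OF \<psi>(1)] by metis
    have near: "\<bar>weighted_energy u n \<psi> - weighted_energy u n f\<bar> \<le> e / 4" for n
      using weighted_energy_near[OF Cc_funs_measurable[OF \<psi>(1)] C(1) Cc_funs_measurable[OF f] C(2) \<psi>(3), of n]
        mult_left_mono[OF S(2)[of n], of d] d by linarith
    have "Cauchy (\<lambda>n. weighted_energy u n \<psi>)"
      using weighted_energy_tendsto_formula[OF \<psi>(1,2)]
        by (intro convergent_Cauchy) (auto simp: convergent_def)
    then obtain M where M: "\<And>i j. M \<le> i \<Longrightarrow> M \<le> j \<Longrightarrow> dist (weighted_energy u i \<psi>) (weighted_energy u j \<psi>) < e / 4"
      using metric_CauchyD[of "\<lambda>n. weighted_energy u n \<psi>" "e / 4"] e by auto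
    have "dist (weighted_energy u i f) (weighted_energy u j f) < e" if "M \<le> i" "M \<le> j" for i j
      using near[of i] near[of j] M[OF that] e unfolding dist_real_def by linarith
    then show "\<exists>M. \<forall>i\<ge>M. \<forall>j\<ge>M. dist (weighted_energy u i f) (weighted_energy u j f) < e" by blast
  qed
  then show ?thesis by (rule Cauchy_convergent)
qed

lemma weighted_energy_tendsto_limit_functional: "f \<in> Cc_funs \<Longrightarrow> (\<lambda>n. weighted_energy u n f) \<longlonglongrightarrow> limit_functional f"
  unfolding limit_functional_def using weighted_energy_convergent convergent_LIMSEQ_iff by blast

lemma limit_functional_add_scaled:
  assumes f: "f \<in> Cc_funs" and g: "g \<in> Cc_funs"
  shows "limit_functional (\<lambda>x. f x + t * g x) = limit_functional f + t * limit_functional g"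
proof -
  obtain C1 C2 where C: "\<And>x. \<bar>f x\<bar> \<le> C1" "\<And>x. \<bar>g x\<bar> \<le> C2"
    using Cc_funs_bounded[OF f] Cc_funs_bounded[OF g] by metis
  have "(\<lambda>n. weighted_energy u n f + t * weighted_energy u n g) \<longlonglongrightarrow> limit_functional f + t * limit_functional g"
    by (intro tendsto_intros weighted_energy_tendsto_limit_functional f g)
  then have "(\<lambda>n. weighted_energy u n (\<lambda>x. f x + t * g x)) \<longlonglongrightarrow> limit_functional f + t * limit_functional g"
    by (simp add: weighted_energy_add[OF Cc_funs_measurable[OF f] C(1) Cc_funs_measurable[OF g] C(2)])
  moreover have "(\<lambda>n. weighted_energy u n (\<lambda>x. f x + t * g x)) \<longlonglongrightarrow> limit_functional (\<lambda>x. f x + t * g x)"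
    by (intro weighted_energy_tendsto_limit_functional Cc_funs_add Cc_funs_scale f g)
  ultimately show ?thesis using LIMSEQ_unique by blast
qed

sublocale bounded_positive_functional limit_functional mass
proof
  fix f g :: "'a \<Rightarrow> real" and c D :: real
  assume f: "f \<in> Cc_funs"
  show "limit_functional (\<lambda>x. f x + g x) = limit_functional f + limit_functional g" if "g \<in> Cc_funs"
    using limit_functional_add_scaled[OF f that, of 1] by simp
  have zero: "limit_functional (\<lambda>x. 0) = 0"
    using limit_functional_add_scaled[OF Cc_funs_zero Cc_funs_zero, of 1] by simp
  show "limit_functional (\<lambda>x. c * f x) = c * limit_functional f"
    using limit_functional_add_scaled[OF Cc_funs_zero f, of c] zero by simp
  show "0 \<le> limit_functional f" if "\<And>x. 0 \<le> f x"
    using that by (intro LIMSEQ_le_const[OF weighted_energy_tendsto_limit_functional[OF f]])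
      (auto simp: weighted_energy_def intro!: integral_nonneg)
  show "\<bar>limit_functional f\<bar> \<le> mass * D" if D: "\<And>x. \<bar>f x\<bar> \<le> D"
  proof (rule LIMSEQ_le)
    show "(\<lambda>n. \<bar>weighted_energy u n f\<bar>) \<longlonglongrightarrow> \<bar>limit_functional f\<bar>"
      by (intro tendsto_intros weighted_energy_tendsto_limit_functional f)
    show "(\<lambda>n. energy n u * D) \<longlonglongrightarrow> mass * D" by (intro tendsto_intros energy_tendsto_mass)
    show "\<exists>N. \<forall>n\<ge>N. \<bar>weighted_energy u n f\<bar> \<le> energy n u * D"
      using weighted_energy_bound[OF u Cc_funs_measurable[OF f] D] by (simp add: mult.commute)
  qed
qed

text \<open>
  Truncation keeps an approximant inside the support of the function that it approximates.
\<close>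

lemma B_pos_part:
  assumes f: "f \<in> B" and e: "0 \<le> e" shows "(\<lambda>x. max 0 (f x - e)) \<in> B"
proof (rule B_dominated[OF f f, of _ 1])
  show "(\<lambda>x. max 0 (f x - e)) \<in> borel_measurable borel"
    using B_measurable[OF f] by measurable
  show "\<bar>max 0 (f x - e)\<bar> \<le> 1 * (\<bar>f x\<bar> + \<bar>f x\<bar>)" for x using e by auto
  show "\<bar>max 0 (f x - e) - max 0 (f y - e)\<bar> \<le> 1 * (\<bar>f x - f y\<bar> + \<bar>f x - f y\<bar>)" for x y
    by (cases "f x \<le> e"; cases "f y \<le> e") (auto simp: max_def)
qed simp

lemma radon_integrable_Cc_funs:
  fixes f :: "'a \<Rightarrow> real"
  assumes \<Gamma>: "radon_measure \<Gamma>" and f: "f \<in> Cc_funs"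
  shows "integrable \<Gamma> f"
proof -
  define S where "S = closure {x. f x \<noteq> 0}"
  have S: "compact S" using f by (simp add: S_def Cc_funs_def)
  have sets: "sets \<Gamma> = sets borel" using \<Gamma> by (simp add: radon_measure_def)
  obtain D where D: "0 < D" "\<And>x. \<bar>f x\<bar> \<le> D" using Cc_funs_bounded[OF f] by blast
  show ?thesis
  proof (rule Bochner_Integration.integrable_bound)
    show "integrable \<Gamma> (\<lambda>x. D * indicator S x)"
    proof (intro integrable_mult_right integrable_real_indicator)
      show "S \<in> sets \<Gamma>" unfolding sets using S by (rule borel_compact)
      show "emeasure \<Gamma> S < \<infinity>" using \<Gamma> S by (simp add: radon_measure_def)
    qed
    show "f \<in> borel_measurable \<Gamma>"
      using Cc_funs_measurable[OF f] unfolding measurable_cong_sets[OF sets refl] .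
    have "\<bar>f x\<bar> \<le> D * indicator S x" for x
      using D(2)[of x] closure_subset[of "{x. f x \<noteq> 0}"] by (cases "x \<in> S") (auto simp: S_def)
    then show "AE x in \<Gamma>. norm (f x) \<le> norm (D * indicator S x)"
      by (intro AE_I2) (simp add: order_trans[OF _ abs_ge_self])
  qed
qed

text \<open>
  The measure is finite on compact sets only, so the approximants of \<open>f\<close> must be supported where \<open>f\<close> is.
  If \<open>f\<close> is nonnegative and \<open>\<psi>\<close> is within \<open>d\<close> of \<open>f\<close>, then \<open>max 0 (\<psi> - d)\<close> vanishes with \<open>f\<close> and is within
  \<open>2 * d\<close> of it.
\<close>

lemma radon_integral_eq_limit_functional:
  assumes \<Gamma>: "radon_measure \<Gamma>"
    and eq: "\<And>\<psi>. \<psi> \<in> Cc_funs \<Longrightarrow> \<psi> \<in> B \<Longrightarrow> integral\<^sup>L \<Gamma> \<psi> = limit_functional \<psi>"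
    and f: "f \<in> Cc_funs"
  shows "integral\<^sup>L \<Gamma> f = limit_functional f"
proof -
  have pos: "integral\<^sup>L \<Gamma> f = limit_functional f" if f: "f \<in> Cc_funs" and f0: "\<And>x. 0 \<le> f x" for f
  proof -
    define S where "S = closure {x. f x \<noteq> 0}"
    have S: "compact S" using f by (simp add: S_def Cc_funs_def)
    have off: "f x = 0" if "x \<notin> S" for x
      using that closure_subset[of "{x. f x \<noteq> 0}"] by (auto simp: S_def)
    have S': "S \<in> sets \<Gamma>" "emeasure \<Gamma> S < \<infinity>"
      using \<Gamma> S by (auto simp: radon_measure_def intro: borel_compact)
    have ind: "integrable \<Gamma> (indicator S :: 'a \<Rightarrow> real)" using S' by (rule integrable_real_indicator)
    define \<kappa> where "\<kappa> = measure \<Gamma> S + mass"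
    have \<kappa>: "0 \<le> \<kappa>" by (simp add: \<kappa>_def mass_nonneg)
    have bd: "\<bar>integral\<^sup>L \<Gamma> f - limit_functional f\<bar> \<le> 2 * d * \<kappa>" if d: "0 < d" for d
    proof -
      obtain \<psi> where \<psi>: "\<psi> \<in> Cc_funs" "\<psi> \<in> B" "\<And>x. \<bar>\<psi> x - f x\<bar> \<le> d"
        using dense[OF f d] by blast
      define g where "g = (\<lambda>x. max 0 (\<psi> x - d))"
      have g: "g \<in> Cc_funs" "g \<in> B"
        using \<psi>(1,2) d by (auto simp: g_def intro!: Cc_funs_pos_part B_pos_part)
      have close: "\<bar>f x - g x\<bar> \<le> 2 * d * indicator S x" for x
        using \<psi>(3)[of x] f0[of x] off[of x] d by (cases "x \<in> S") (auto simp: g_def)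
      have close': "\<bar>f x + (-1) * g x\<bar> \<le> 2 * d" for x
        using close[of x] d by (cases "x \<in> S") auto
      have "\<bar>integral\<^sup>L \<Gamma> f - integral\<^sup>L \<Gamma> g\<bar> = \<bar>\<integral>x. f x - g x \<partial>\<Gamma>\<bar>"
        using radon_integrable_Cc_funs[OF \<Gamma> f] radon_integrable_Cc_funs[OF \<Gamma> g(1)] by simp
      also have "\<dots> \<le> (\<integral>x. \<bar>f x - g x\<bar> \<partial>\<Gamma>)" by (rule integral_abs_bound)
      also have "\<dots> \<le> (\<integral>x. 2 * d * indicator S x \<partial>\<Gamma>)"
      proof (rule integral_mono)
        show "integrable \<Gamma> (\<lambda>x. \<bar>f x - g x\<bar>)"
          using radon_integrable_Cc_funs[OF \<Gamma> f] radon_integrable_Cc_funs[OF \<Gamma> g(1)] by auto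
        show "integrable \<Gamma> (\<lambda>x. 2 * d * indicator S x)" using ind by simp
      qed (rule close)
      also have "\<dots> = 2 * d * measure \<Gamma> S" using S' by simp
      finally have 1: "\<bar>integral\<^sup>L \<Gamma> f - integral\<^sup>L \<Gamma> g\<bar> \<le> 2 * d * measure \<Gamma> S" .
      have "limit_functional (\<lambda>x. f x + (-1) * g x) = limit_functional f + (-1) * limit_functional g"
        by (rule limit_functional_add_scaled[OF f g(1)])
      then have 2: "\<bar>limit_functional f - limit_functional g\<bar> \<le> mass * (2 * d)"
        using bound[OF Cc_funs_add[OF f Cc_funs_scale[OF g(1)]] close'] by simp
      have "2 * d * \<kappa> = 2 * d * measure \<Gamma> S + mass * (2 * d)" by (simp add: \<kappa>_def algebra_simps)
      with 1 2 eq[OF g] show ?thesis by linarith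
    qed
    have "\<bar>integral\<^sup>L \<Gamma> f - limit_functional f\<bar> \<le> 0"
    proof (rule field_le_epsilon)
      fix e :: real assume e: "0 < e"
      have "2 * (e / (2 * (\<kappa> + 1))) * \<kappa> \<le> e" using e \<kappa> by (simp add: field_simps)
      then show "\<bar>integral\<^sup>L \<Gamma> f - limit_functional f\<bar> \<le> 0 + e"
        using bd[of "e / (2 * (\<kappa> + 1))"] e \<kappa> by simp
    qed
    then show ?thesis by simp
  qed
  define f1 where "f1 = (\<lambda>x. max 0 (f x - 0))"
  define f2 where "f2 = (\<lambda>x. max 0 ((-1) * f x - 0))"
  have f1: "f1 \<in> Cc_funs" "\<And>x. 0 \<le> f1 x"
    unfolding f1_def by (rule Cc_funs_pos_part[OF f]; simp) simp
  have f2: "f2 \<in> Cc_funs" "\<And>x. 0 \<le> f2 x"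
    unfolding f2_def by (rule Cc_funs_pos_part[OF Cc_funs_scale[OF f]]; simp) simp
  have split: "f = (\<lambda>x. f1 x + (-1) * f2 x)" by (auto simp: f1_def f2_def)
  have "integral\<^sup>L \<Gamma> f = integral\<^sup>L \<Gamma> f1 + (-1) * integral\<^sup>L \<Gamma> f2"
    unfolding split using radon_integrable_Cc_funs[OF \<Gamma> f1(1)] radon_integrable_Cc_funs[OF \<Gamma> f2(1)] by simp
  also have "\<dots> = limit_functional f1 + (-1) * limit_functional f2" by (simp add: pos f1 f2)
  also have "\<dots> = limit_functional f"
    unfolding split by (rule limit_functional_add_scaled[OF f1(1) f2(1), symmetric])
  finally show ?thesis .
qed

text \<open>
  Monotone convergence along functions in \<open>Cc_funs\<close> that increase to \<open>1\<close>.
\<close>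

lemma radon_emeasure_UNIV_le_mass:
  assumes \<Gamma>: "radon_measure \<Gamma>" and eq: "\<And>f. f \<in> Cc_funs \<Longrightarrow> integral\<^sup>L \<Gamma> f = limit_functional f"
  shows "emeasure \<Gamma> UNIV \<le> ennreal mass"
proof -
  have sets: "sets \<Gamma> = sets borel" using \<Gamma> by (simp add: radon_measure_def)
  have space: "space \<Gamma> = UNIV" using sets_eq_imp_space_eq[OF sets] by simp
  obtain \<phi> :: "nat \<Rightarrow> 'a \<Rightarrow> real" where \<phi>: "\<And>n. \<phi> n \<in> Cc_funs" "\<And>n x. 0 \<le> \<phi> n x"
    "\<And>n x. \<phi> n x \<le> indicator UNIV x" "\<And>x. incseq (\<lambda>n. \<phi> n x)" "\<And>x. (\<lambda>n. \<phi> n x) \<longlonglongrightarrow> indicator UNIV x"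
    using Cc_funs_increasing_to_indicator[OF locally_compact open_UNIV] by metis
  have "(\<lambda>n. \<integral>\<^sup>+x. ennreal (\<phi> n x) \<partial>\<Gamma>) \<longlonglongrightarrow> (\<integral>\<^sup>+x. 1 \<partial>\<Gamma>)"
  proof (rule nn_integral_LIMSEQ)
    show "incseq (\<lambda>n x. ennreal (\<phi> n x))"
      using \<phi>(4) by (auto simp: incseq_def le_fun_def intro!: ennreal_leI)
    show "(\<lambda>x. ennreal (\<phi> n x)) \<in> borel_measurable \<Gamma>" for n
      using Cc_funs_measurable[OF \<phi>(1)] unfolding measurable_cong_sets[OF sets refl] by measurable
    show "(\<lambda>n. ennreal (\<phi> n x)) \<longlonglongrightarrow> 1" for x
      using tendsto_ennrealI[OF \<phi>(5)[of x]] by simp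
  qed
  moreover have "(\<integral>\<^sup>+x. ennreal (\<phi> n x) \<partial>\<Gamma>) \<le> ennreal mass" for n
  proof -
    have "(\<integral>\<^sup>+x. ennreal (\<phi> n x) \<partial>\<Gamma>) = ennreal (limit_functional (\<phi> n))"
      unfolding eq[OF \<phi>(1), symmetric]
      using radon_integrable_Cc_funs[OF \<Gamma> \<phi>(1)] \<phi>(2) by (intro nn_integral_eq_integral) auto
    also have "limit_functional (\<phi> n) \<le> mass"
      using bound[OF \<phi>(1), of n 1] \<phi>(2,3) by auto
    finally show ?thesis by (simp add: ennreal_leI)
  qed
  ultimately have "(\<integral>\<^sup>+x. 1 \<partial>\<Gamma>) \<le> ennreal mass"
    by (intro LIMSEQ_le_const2) auto
  then show ?thesis by (simp add: space)
qed

text \<open>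
  Both sides are Lipschitz in \<open>f\<close> for the supremum norm, with constants that do not depend on \<open>n\<close>.
\<close>

lemma weighted_energy_tendsto_integral:
  assumes sets: "sets \<Gamma> = sets borel" and fin: "finite_measure \<Gamma>"
    and eq: "\<And>f. f \<in> Cc_funs \<Longrightarrow> integral\<^sup>L \<Gamma> f = limit_functional f"
    and f: "f \<in> borel_measurable borel" "\<And>x. \<bar>f x\<bar> \<le> D"
    and approx: "\<And>e. 0 < e \<Longrightarrow> \<exists>\<psi>\<in>Cc_funs. \<forall>x. \<bar>\<psi> x - f x\<bar> \<le> e"
  shows "(\<lambda>n. weighted_energy u n f) \<longlonglongrightarrow> integral\<^sup>L \<Gamma> f"
proof (rule LIMSEQ_I)
  fix e :: real assume e: "0 < e"
  interpret finite_measure \<Gamma> by fact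
  obtain S where S: "0 \<le> S" "\<And>n. energy n u \<le> S" using energy_bounded[OF u] by blast
  define T where "T = measure \<Gamma> (space \<Gamma>)"
  define d where "d = e / (3 * (S + T + 1))"
  have T: "0 \<le> T" by (simp add: T_def)
  have d: "0 < d" "d * (S + T) \<le> e / 3" using e S(1) T by (auto simp: d_def field_simps)
  obtain \<psi> where \<psi>: "\<psi> \<in> Cc_funs" "\<And>x. \<bar>\<psi> x - f x\<bar> \<le> d" using approx[OF d(1)] by blast
  obtain D' where D': "\<And>x. \<bar>\<psi> x\<bar> \<le> D'" using Cc_funs_bounded[OF \<psi>(1)] by blast
  have int: "integrable \<Gamma> g" if "g \<in> borel_measurable borel" "\<And>x. \<bar>g x\<bar> \<le> c" for g :: "'a \<Rightarrow> real" and c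
    using that by (intro integrable_const_bound[where B = c]) (auto simp: measurable_cong_sets[OF sets refl])
  have \<psi>_int: "integrable \<Gamma> \<psi>" by (rule int[OF Cc_funs_measurable[OF \<psi>(1)] D'])
  have f_int: "integrable \<Gamma> f" by (rule int[OF f])
  have "\<bar>integral\<^sup>L \<Gamma> \<psi> - integral\<^sup>L \<Gamma> f\<bar> = \<bar>\<integral>x. \<psi> x - f x \<partial>\<Gamma>\<bar>"
    using \<psi>_int f_int by simp
  also have "\<dots> \<le> (\<integral>x. \<bar>\<psi> x - f x\<bar> \<partial>\<Gamma>)" by (rule integral_abs_bound)
  also have "\<dots> \<le> (\<integral>x. d \<partial>\<Gamma>)"
    using \<psi>_int f_int \<psi>(2) by (intro integral_mono) auto
  also have "\<dots> = d * T" by (simp add: T_def)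
  finally have 1: "\<bar>integral\<^sup>L \<Gamma> \<psi> - integral\<^sup>L \<Gamma> f\<bar> \<le> d * T" .
  have 2: "\<bar>weighted_energy u n \<psi> - weighted_energy u n f\<bar> \<le> d * S" for n
    using weighted_energy_near[OF Cc_funs_measurable[OF \<psi>(1)] D' f \<psi>(2), of n]
      mult_left_mono[OF S(2)[of n], of d] d by linarith
  have "\<exists>N. \<forall>n\<ge>N. norm (weighted_energy u n \<psi> - integral\<^sup>L \<Gamma> \<psi>) < e / 3"
    using LIMSEQ_D[OF weighted_energy_tendsto_limit_functional[OF \<psi>(1)], of "e / 3"] e
      by (simp add: eq[OF \<psi>(1)])
  then obtain N where N: "\<And>n. N \<le> n \<Longrightarrow> \<bar>weighted_energy u n \<psi> - integral\<^sup>L \<Gamma> \<psi>\<bar> < e / 3" by auto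
  have "norm (weighted_energy u n f - integral\<^sup>L \<Gamma> f) < e" if "N \<le> n" for n
    using 1 2[of n] N[OF that] d(2)[unfolded distrib_left] e unfolding real_norm_def by linarith
  then show "\<exists>N. \<forall>n\<ge>N. norm (weighted_energy u n f - integral\<^sup>L \<Gamma> f) < e" by blast
qed

end

section \<open>The energy measure of a bounded continuous function\<close>

lemma Cc_iff: "\<phi> \<in> Cc \<longleftrightarrow> apply_bcontfun \<phi> \<in> Cc_funs"
  by (simp add: Cc_def Cc_funs_def)

lemma Cc_funs_eq_apply_bcontfun:
  assumes "f \<in> Cc_funs" obtains \<phi> where "\<phi> \<in> Cc" "apply_bcontfun \<phi> = f"
proof -
  obtain D where "\<And>x. \<bar>f x\<bar> \<le> D" using Cc_funs_bounded[OF assms] by blast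
  then have "f \<in> bcontfun" by (intro bcontfun_normI Cc_funs_continuous assms) auto
  then show thesis using assms that by (metis Cc_iff bcontfunE)
qed

theorem theorem4p2:
  fixes p :: real
    and m :: "'a::{metric_space, second_countable_topology} measure"
    and k :: "real \<Rightarrow> 'a \<times> 'a \<Rightarrow> ennreal"
    and r :: "nat \<Rightarrow> real"
    and u :: "'a \<Rightarrow>\<^sub>C real"
  assumes "1 < p"
    and "locally_compact_space (euclidean :: 'a topology)"
    and "\<exists>x y :: 'a. x \<noteq> y"
    and "sets m = sets borel"
    and "sigma_finite_measure m"
    and "\<And>U. open U \<Longrightarrow> U \<noteq> {} \<Longrightarrow> 0 < emeasure m U"
    and "\<And>s. 0 < s \<Longrightarrow> k s \<in> borel_measurable borel"
    and "weak_monotone p m k"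
    and "asymptotically_local m k"
    and "\<And>n. 0 < r n"
    and "r \<longlonglongrightarrow> 0"
    and "\<And>f. f \<in> B_space p m k \<Longrightarrow> \<exists>L. L < \<infinity> \<and> (\<lambda>n. J_fun p m k (r n) f) \<longlonglongrightarrow> L"
    and "Cc \<subseteq> closure {\<phi> \<in> Cc. apply_bcontfun \<phi> \<in> B_space p m k}"
    and "apply_bcontfun u \<in> B_space p m k"
  shows "(\<exists>!\<Gamma>. is_p_energy_measure p m k r u \<Gamma>) \<and>
    (\<forall>\<Gamma>. is_p_energy_measure p m k r u \<Gamma> \<longrightarrow>
       emeasure \<Gamma> UNIV \<le> p_energy p m k r (apply_bcontfun u) \<and>
       p_energy p m k r (apply_bcontfun u) < \<infinity> \<and>
       (\<forall>\<phi>\<in>C0. (\<lambda>n. weighted_J p m k (r n) (apply_bcontfun u) (apply_bcontfun \<phi>))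
                  \<longlonglongrightarrow> (\<integral>x. apply_bcontfun \<phi> x \<partial>\<Gamma>)))"
proof -
  interpret kernel_energy p m k r
    by (rule kernel_energy.intro) (fact assms)+
  interpret energy_measure p m k r "apply_bcontfun u" "norm u"
  proof
    fix f :: "'a \<Rightarrow> real" and e :: real
    assume "f \<in> Cc_funs" and e: "0 < e"
    then obtain \<phi> where \<phi>: "\<phi> \<in> Cc" "apply_bcontfun \<phi> = f" using Cc_funs_eq_apply_bcontfun by blast
    then have "\<phi> \<in> closure {\<phi> \<in> Cc. apply_bcontfun \<phi> \<in> B}" using assms(13) by blast
    then obtain \<psi> where \<psi>: "\<psi> \<in> Cc" "apply_bcontfun \<psi> \<in> B" "dist \<psi> \<phi> < e"
      using e unfolding closure_approachable by blast
    then have "\<bar>apply_bcontfun \<psi> x - f x\<bar> \<le> e" for x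
      using dist_bounded[of \<psi> x \<phi>] \<phi>(2) by (simp add: dist_real_def)
    then show "\<exists>\<psi>\<in>Cc_funs \<inter> B. \<forall>x. \<bar>\<psi> x - f x\<bar> \<le> e"
      using \<psi>(1,2) by (auto simp: Cc_iff)
  next
    show "\<bar>apply_bcontfun u x\<bar> \<le> norm u" for x using norm_bounded[of u x] by simp
  qed (fact assms)+
  \<comment> \<open>The weighted energies converge to both sides.\<close>
  have formula: "p_energy_form p m k r (apply_bcontfun u) (\<lambda>x. apply_bcontfun u x * f x)
     - ((p - 1) / p) powr (p - 1) *
       p_energy_form p m k r (\<lambda>x. \<bar>apply_bcontfun u x\<bar> powr (p / (p - 1))) f = limit_functional f"
    if "f \<in> Cc_funs" "f \<in> B" for f
    using LIMSEQ_unique[OF weighted_energy_tendsto_formula[OF that] weighted_energy_tendsto_limit_functional[OF that(1)]] .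
  have iff: "is_p_energy_measure p m k r u \<Gamma> \<longleftrightarrow>
      radon_measure \<Gamma> \<and> (\<forall>f\<in>Cc_funs. integral\<^sup>L \<Gamma> f = limit_functional f)" for \<Gamma>
  proof
    assume \<Gamma>: "is_p_energy_measure p m k r u \<Gamma>"
    then have radon: "radon_measure \<Gamma>" by (simp add: is_p_energy_measure_def)
    have "integral\<^sup>L \<Gamma> f = limit_functional f" if f: "f \<in> Cc_funs" "f \<in> B" for f
    proof -
      obtain \<phi> where "\<phi> \<in> Cc" "apply_bcontfun \<phi> = f" using Cc_funs_eq_apply_bcontfun[OF f(1)] .
      then show ?thesis using \<Gamma> f(2) formula[OF f] unfolding is_p_energy_measure_def by auto
    qed
    then show "radon_measure \<Gamma> \<and> (\<forall>f\<in>Cc_funs. integral\<^sup>L \<Gamma> f = limit_functional f)"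
      using radon_integral_eq_limit_functional[OF radon] radon by blast
  next
    assume "radon_measure \<Gamma> \<and> (\<forall>f\<in>Cc_funs. integral\<^sup>L \<Gamma> f = limit_functional f)"
    then show "is_p_energy_measure p m k r u \<Gamma>"
      unfolding is_p_energy_measure_def using formula by (auto simp: Cc_iff)
  qed
  have energy: "p_energy p m k r (apply_bcontfun u) < \<infinity>"
    "ennreal mass = p_energy p m k r (apply_bcontfun u)"
    using energy_tendsto_p_energy(1)[OF u] by (simp_all add: mass_def)
  have total: "emeasure \<Gamma> UNIV \<le> ennreal mass" if "is_p_energy_measure p m k r u \<Gamma>" for \<Gamma>
    using that radon_emeasure_UNIV_le_mass unfolding iff by blast
  have sets: "sets \<Gamma> = sets borel" if "is_p_energy_measure p m k r u \<Gamma>" for \<Gamma>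
    using that by (simp add: is_p_energy_measure_def radon_measure_def)
  have finite: "finite_measure \<Gamma>" if "is_p_energy_measure p m k r u \<Gamma>" for \<Gamma>
  proof (rule finite_measureI)
    have "emeasure \<Gamma> UNIV < top" using total[OF that] by (rule order_le_less_trans) simp
    then show "emeasure \<Gamma> (space \<Gamma>) \<noteq> \<infinity>"
      using sets_eq_imp_space_eq[OF sets[OF that]] by simp
  qed
  obtain \<mu> where \<mu>: "sets \<mu> = sets borel" "emeasure \<mu> UNIV \<le> ennreal mass"
    "\<And>f. f \<in> Cc_funs \<Longrightarrow> integral\<^sup>L \<mu> f = limit_functional f"
    using riesz_representation by blast
  have "radon_measure \<mu>"
    unfolding radon_measure_def
  proof (intro conjI allI impI \<mu>(1))
    fix A :: "'a set"
    have "emeasure \<mu> A \<le> emeasure \<mu> UNIV" using \<mu>(1) by (intro emeasure_mono) auto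
    also have "\<dots> \<le> ennreal mass" by (rule \<mu>(2))
    also have "\<dots> < \<infinity>" by simp
    finally show "emeasure \<mu> A < \<infinity>" .
  qed
  then have "is_p_energy_measure p m k r u \<mu>" using \<mu>(3) by (simp add: iff)
  moreover have "\<Gamma> = \<Gamma>'" if \<Gamma>: "is_p_energy_measure p m k r u \<Gamma>" and \<Gamma>': "is_p_energy_measure p m k r u \<Gamma>'" for \<Gamma> \<Gamma>'
    using locally_compact sets[OF \<Gamma>] sets[OF \<Gamma>'] finite[OF \<Gamma>] finite[OF \<Gamma>']
    by (rule finite_measure_eqI_Cc_funs) (use \<Gamma> \<Gamma>' iff in auto)
  ultimately have "\<exists>!\<Gamma>. is_p_energy_measure p m k r u \<Gamma>" by blast
  moreover have "(\<lambda>n. weighted_J p m k (r n) (apply_bcontfun u) (apply_bcontfun \<phi>)) \<longlonglongrightarrow> (\<integral>x. apply_bcontfun \<phi> x \<partial>\<Gamma>)"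
    if \<Gamma>: "is_p_energy_measure p m k r u \<Gamma>" and \<phi>: "\<phi> \<in> C0" for \<Gamma> \<phi>
  proof -
    have meas: "apply_bcontfun \<phi> \<in> borel_measurable borel" by (intro borel_measurable_continuous_onI) simp
    have bd: "\<bar>apply_bcontfun \<phi> x\<bar> \<le> norm \<phi>" for x using norm_bounded[of \<phi> x] by simp
    have "\<exists>\<psi>\<in>Cc_funs. \<forall>x. \<bar>\<psi> x - apply_bcontfun \<phi> x\<bar> \<le> e" if e: "0 < e" for e
    proof -
      obtain \<psi> where \<psi>: "\<psi> \<in> Cc" "dist \<psi> \<phi> < e"
        using \<phi> e unfolding C0_def closure_approachable by blast
      then have "\<bar>apply_bcontfun \<psi> x - apply_bcontfun \<phi> x\<bar> \<le> e" for x
        using dist_bounded[of \<psi> x \<phi>] by (simp add: dist_real_def)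
      then show ?thesis using \<psi>(1) by (auto simp: Cc_iff)
    qed
    then have "(\<lambda>n. weighted_energy (apply_bcontfun u) n (apply_bcontfun \<phi>)) \<longlonglongrightarrow> integral\<^sup>L \<Gamma> (apply_bcontfun \<phi>)"
      using \<Gamma> iff by (intro weighted_energy_tendsto_integral[OF sets[OF \<Gamma>] finite[OF \<Gamma>] _ meas bd]) auto
    then show ?thesis by (simp add: weighted_J_eq_weighted_energy[OF u meas bd])
  qed
  ultimately show ?thesis using total energy by simp
qed

end
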